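(* Let $R$ be a dp-minimal integral domain (possibly expanded by additional structure), and let $K=\mathrm{Frac}(R)$. If $R$ is not a valuation ring, then there exist a valuation subring $\mathcal{O}$ of $K$, a proper ideal $I \trianglelefteq \mathcal{O}$, and a finite subring $R_0$ of $\mathcal{O}/I$ such that $R$ is the preimage of $R_0$ under the quotient map $\mathcal{O}\to\mathcal{O}/I$. Moreover, the data $(\mathcal{O},I,R_0)$ can be chosen to be definable in $R$.
   Context: Rings are commutative with identity. A structure $M$ is dp-minimal if it has dp-rank $1$ (in particular it is infinite); an integral domain is dp-minimal if its first-order theory (in the given language, which may include extra structure beyond $+,\cdot$) has dp-rank $1$. Valuations may be trivial, so a field counts as a valuation ring (of itself). *)

theory Defs
  imports "HOL-Algebra.Subrings" "HOL-Algebra.QuotRing" "HOL-Library.Extended_Nat"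
begin

section \<open>First-order logic\<close>

text \<open>
  As is common for first-order terms in Isabelle, a symbol is identified by its name together with
  the number of arguments it is applied to, so no separate arity function is needed: the names
  \<^typ>\<open>'f\<close> and \<^typ>\<open>'r\<close> determine the language, and a language with prescribed arities is
  obtained by interpreting a name trivially on argument lists of the other lengths.
\<close>

datatype 'f tm = Var nat | App 'f "'f tm list"

datatype ('f, 'r) fm =
    Eq "'f tm" "'f tm"
  | Rel 'r "'f tm list"
  | Neg "('f, 'r) fm"
  | Conj "('f, 'r) fm" "('f, 'r) fm"
  | Ex nat "('f, 'r) fm"

primrec tm_vars :: "'f tm \<Rightarrow> nat set" where
  "tm_vars (Var v) = {v}"
| "tm_vars (App f ts) = (\<Union>V \<in> set (map tm_vars ts). V)"

primrec fm_vars :: "('f, 'r) fm \<Rightarrow> nat set" where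
  "fm_vars (Eq s t) = tm_vars s \<union> tm_vars t"
| "fm_vars (Rel r ts) = (\<Union>t \<in> set ts. tm_vars t)"
| "fm_vars (Neg \<phi>) = fm_vars \<phi>"
| "fm_vars (Conj \<phi> \<psi>) = fm_vars \<phi> \<union> fm_vars \<psi>"
| "fm_vars (Ex v \<phi>) = fm_vars \<phi> - {v}"

record ('f, 'r, 'a) fo_struct =
  dom :: "'a set"
  funs :: "'f \<Rightarrow> 'a list \<Rightarrow> 'a"
  rels :: "'r \<Rightarrow> 'a list \<Rightarrow> bool"

definition is_fo_struct :: "('f, 'r, 'a) fo_struct \<Rightarrow> bool" where
  "is_fo_struct M \<longleftrightarrow> dom M \<noteq> {} \<and> (\<forall>f xs. set xs \<subseteq> dom M \<longrightarrow> funs M f xs \<in> dom M)"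

primrec tm_val :: "('f, 'r, 'a) fo_struct \<Rightarrow> (nat \<Rightarrow> 'a) \<Rightarrow> 'f tm \<Rightarrow> 'a" where
  "tm_val M e (Var v) = e v"
| "tm_val M e (App f ts) = funs M f (map (tm_val M e) ts)"

primrec sat :: "('f, 'r, 'a) fo_struct \<Rightarrow> (nat \<Rightarrow> 'a) \<Rightarrow> ('f, 'r) fm \<Rightarrow> bool" where
  "sat M e (Eq s t) \<longleftrightarrow> tm_val M e s = tm_val M e t"
| "sat M e (Rel r ts) \<longleftrightarrow> rels M r (map (tm_val M e) ts)"
| "sat M e (Neg \<phi>) \<longleftrightarrow> \<not> sat M e \<phi>"
| "sat M e (Conj \<phi> \<psi>) \<longleftrightarrow> sat M e \<phi> \<and> sat M e \<psi>"
| "sat M e (Ex v \<phi>) \<longleftrightarrow> (\<exists>a \<in> dom M. sat M (e(v := a)) \<phi>)"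

definition holds :: "('f, 'r, 'a) fo_struct \<Rightarrow> ('f, 'r) fm \<Rightarrow> bool" where
  "holds M \<phi> \<longleftrightarrow> (\<forall>e. range e \<subseteq> dom M \<longrightarrow> sat M e \<phi>)"

definition Th :: "('f, 'r, 'a) fo_struct \<Rightarrow> ('f, 'r) fm set" where
  "Th M = {\<phi>. fm_vars \<phi> = {} \<and> holds M \<phi>}"

definition is_model :: "('f, 'r, 'a) fo_struct \<Rightarrow> ('f, 'r) fm set \<Rightarrow> bool" where
  "is_model N T \<longleftrightarrow> is_fo_struct N \<and> (\<forall>\<phi> \<in> T. holds N \<phi>)"

text \<open>
  \<^term>\<open>D\<close> is a definable (with parameters) set of \<^term>\<open>n\<close>-tuples. The variables below
  \<^term>\<open>n\<close> stand for the coordinates of the tuple; the remaining ones are interpreted by the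
  parameters \<^term>\<open>c\<close>, of which only the finitely many occurring in \<^term>\<open>\<phi>\<close> matter.
\<close>

definition definable :: "('f, 'r, 'a) fo_struct \<Rightarrow> nat \<Rightarrow> 'a list set \<Rightarrow> bool" where
  "definable M n D \<longleftrightarrow>
     (\<exists>\<phi> c. range c \<subseteq> dom M \<and>
        D = {xs. length xs = n \<and> set xs \<subseteq> dom M \<and>
                 sat M (\<lambda>k. if k < n then xs ! k else c k) \<phi>})"


section \<open>Dp-rank\<close>

text \<open>
  An ict-pattern of depth \<^term>\<open>n\<close> in one object variable: formulas \<open>\<phi> i (x; y)\<close> for
  \<open>i < n\<close> and parameter tuples \<open>b i j\<close> for \<open>j < \<omega>\<close> such that for every \<open>\<eta> : n \<rightarrow> \<omega>\<close> the set
  \<open>{\<phi> i (x; b i (\<eta> i)) | i < n} \<union> {\<not> \<phi> i (x; b i j) | i < n, j \<noteq> \<eta> i}\<close> is realized. Variable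
  \<open>0\<close> is \<open>x\<close>, variable \<open>Suc k\<close> is the \<open>k\<close>-th coordinate of the tuple \<open>y\<close>; the parameter tuples
  are padded to infinite sequences, only finitely many entries being relevant to \<open>\<phi> i\<close>.
\<close>

definition ict_pattern ::
  "('f, 'r, 'a) fo_struct \<Rightarrow> nat \<Rightarrow> (nat \<Rightarrow> ('f, 'r) fm) \<Rightarrow> (nat \<Rightarrow> nat \<Rightarrow> nat \<Rightarrow> 'a) \<Rightarrow> bool" where
  "ict_pattern N n \<phi> b \<longleftrightarrow>
     (\<forall>i<n. \<forall>j. range (b i j) \<subseteq> dom N) \<and>
     (\<forall>\<eta> :: nat \<Rightarrow> nat. \<exists>a \<in> dom N. \<forall>i<n. \<forall>j.
        sat N (case_nat a (b i j)) (\<phi> i) \<longleftrightarrow> j = \<eta> i)"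

text \<open>
  A theory has an ict-pattern if some model of it has one. The type \<^typ>\<open>'f + 'r + nat\<close> is
  large enough to look for models in: a pattern of finite depth together with its realizations
  (one for each \<open>\<eta> \<in> \<omega>\<^sup>n\<close>) involves countably many elements, so by the downward
  Loewenheim-Skolem theorem it lies in an elementary substructure of size at most
  \<open>|'f| + |'r| + \<aleph>\<^sub>0\<close>.
\<close>

definition has_ict_pattern :: "('f, 'r) fm set \<Rightarrow> nat \<Rightarrow> bool" where
  "has_ict_pattern T n \<longleftrightarrow>
     (\<exists>(N :: ('f, 'r, 'f + 'r + nat) fo_struct) \<phi> b. is_model N T \<and> ict_pattern N n \<phi> b)"

text \<open>Infinite dp-ranks are not distinguished from one another.\<close>

definition dp_rank :: "('f, 'r) fm set \<Rightarrow> enat" where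
  "dp_rank T = (SUP n \<in> {n. has_ict_pattern T n}. enat n)"

definition dp_minimal :: "('f, 'r, 'a) fo_struct \<Rightarrow> bool" where
  "dp_minimal M \<longleftrightarrow> dp_rank (Th M) = 1"


section \<open>Rings\<close>

text \<open>
  \<^term>\<open>M\<close> is a structure on the underlying set of \<^term>\<open>S\<close> whose language contains symbols
  \<^term>\<open>addsym\<close> and \<^term>\<open>mulsym\<close> for the ring operations; everything else is extra structure.
\<close>

definition expands_ring ::
  "('f, 'r, 'a) fo_struct \<Rightarrow> 'f \<Rightarrow> 'f \<Rightarrow> ('a, 'm) ring_scheme \<Rightarrow> bool" where
  "expands_ring M addsym mulsym S \<longleftrightarrow>
     is_fo_struct M \<and> dom M = carrier S \<and>
     (\<forall>x \<in> carrier S. \<forall>y \<in> carrier S.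
        funs M addsym [x, y] = x \<oplus>\<^bsub>S\<^esub> y \<and> funs M mulsym [x, y] = x \<otimes>\<^bsub>S\<^esub> y)"

text \<open>\<open>K = Frac R\<close>, with \<open>R\<close> identified with its image in \<open>K\<close>.\<close>

definition is_fraction_field :: "('a, 'm) ring_scheme \<Rightarrow> 'a set \<Rightarrow> bool" where
  "is_fraction_field K R \<longleftrightarrow>
     field K \<and> subdomain R K \<and>
     (\<forall>x \<in> carrier K. \<exists>a \<in> R. \<exists>b \<in> R - {\<zero>\<^bsub>K\<^esub>}. x = a \<otimes>\<^bsub>K\<^esub> inv\<^bsub>K\<^esub> b)"

definition valuation_subring :: "'a set \<Rightarrow> ('a, 'm) ring_scheme \<Rightarrow> bool" where
  "valuation_subring A K \<longleftrightarrow>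
     subring A K \<and> (\<forall>x \<in> carrier K - {\<zero>\<^bsub>K\<^esub>}. x \<in> A \<or> inv\<^bsub>K\<^esub> x \<in> A)"

text \<open>
  Definability in \<^term>\<open>M\<close>, a structure on \<^term>\<open>R\<close>, of subsets of \<open>K = Frac R\<close> and of \<open>A/I\<close> for
  \<open>I \<subseteq> A \<subseteq> K\<close>. These are quotients of definable sets, \<open>K\<close> being the quotient of
  \<open>R \<times> (R - {0})\<close> by equality of fractions, and a subset of a quotient is definable iff its
  preimage is.
\<close>

definition frac_definable ::
  "('f, 'r, 'a) fo_struct \<Rightarrow> ('a, 'm) ring_scheme \<Rightarrow> 'a set \<Rightarrow> 'a set \<Rightarrow> bool" where
  "frac_definable M K R X \<longleftrightarrow>
     definable M 2 {[a, b] | a b. a \<in> R \<and> b \<in> R - {\<zero>\<^bsub>K\<^esub>} \<and> a \<otimes>\<^bsub>K\<^esub> inv\<^bsub>K\<^esub> b \<in> X}"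

definition quot_definable ::
  "('f, 'r, 'a) fo_struct \<Rightarrow> ('a, 'm) ring_scheme \<Rightarrow> 'a set \<Rightarrow> 'a set \<Rightarrow> 'a set \<Rightarrow> 'a set set \<Rightarrow> bool"
  where
  "quot_definable M K R A I Y \<longleftrightarrow> frac_definable M K R {x \<in> A. I +>\<^bsub>K\<lparr>carrier := A\<rparr>\<^esub> x \<in> Y}"

end

theory Submission
  imports Defs
begin

text \<open>
  A dp-minimal structure has no ict-pattern of depth \<open>2\<close>, hence by compactness no finite ones of
  unbounded size. For \<open>c \<in> K\<^sup>\<times>\<close> let \<open>\<iota>(c) = [cR : cR \<inter> R]\<close>, which is also the index in \<open>R\<close> of
  \<open>(R : c) = {x \<in> R. xc \<in> R}\<close>. Cosets of \<open>aR\<close> and \<open>bR\<close> would give large patterns unless there is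
  a \<open>k\<close> with \<open>\<iota>(c) \<le> k\<close> or \<open>\<iota>(c\<inverse>) \<le> k\<close> for all \<open>c\<close>. The set \<open>S\<close> of all \<open>c\<close> with
  \<open>\<iota>(c) \<le> \<iota>(c\<inverse>)\<close>, \<open>\<iota>(c)\<close> finite, is closed under multiplication because indices are
  multiplicative in towers; it satisfies \<open>S \<union> S\<inverse> = K\<^sup>\<times>\<close>, and \<open>\<iota> \<le> k\<close> on \<open>S\<close>. By the Baldwin-Saxl
  argument \<open>J = \<Inter>c\<in>S. (R : c)\<close> is the intersection of finitely many \<open>(R : c)\<close>, so it is definable
  and of finite index in \<open>R\<close>. As \<open>S\<close> is multiplicatively closed, \<open>SJ \<subseteq> J\<close>, so the multiplier ring
  \<open>{c. cJ \<subseteq> J}\<close> contains \<open>S\<close> and is therefore a valuation ring. It contains \<open>R\<close>, and \<open>J\<close> is an ideal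
  of it with \<open>R/J\<close> finite.
\<close>

section \<open>Compactness and Loewenheim-Skolem for ict-patterns\<close>

lemma finite_tm_vars [simp]: "finite (tm_vars t)"
  by (induction t) auto

lemma finite_fm_vars [simp]: "finite (fm_vars \<phi>)"
  by (induction \<phi>) auto

lemma tm_val_cong:
  "(\<And>v. v \<in> tm_vars t \<Longrightarrow> e v = e' v) \<Longrightarrow> tm_val M e t = tm_val M e' t"
proof (induction t)
  case (App f ts)
  then have "map (tm_val M e) ts = map (tm_val M e') ts"
    by (auto intro!: map_cong)
  then show ?case by (simp only: tm_val.simps)
qed auto

lemma sat_cong:
  "(\<And>v. v \<in> fm_vars \<phi> \<Longrightarrow> e v = e' v) \<Longrightarrow> sat M e \<phi> \<longleftrightarrow> sat M e' \<phi>"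
proof (induction \<phi> arbitrary: e e')
  case (Eq s t)
  then have "tm_val M e s = tm_val M e' s" "tm_val M e t = tm_val M e' t"
    by (auto intro!: tm_val_cong)
  then show ?case by simp
next
  case (Rel r ts)
  then have "map (tm_val M e) ts = map (tm_val M e') ts"
    by (auto intro!: map_cong tm_val_cong)
  then show ?case by (simp only: sat.simps)
next
  case (Neg \<phi>)
  have "sat M e \<phi> \<longleftrightarrow> sat M e' \<phi>"
    by (rule Neg.IH) (simp add: Neg.prems)
  then show ?case by simp
next
  case (Conj \<phi> \<psi>)
  have "sat M e \<phi> \<longleftrightarrow> sat M e' \<phi>" "sat M e \<psi> \<longleftrightarrow> sat M e' \<psi>"
    by (rule Conj.IH; simp add: Conj.prems)+
  then show ?case by simp
next
  case (Ex v \<phi>)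
  have "sat M (e(v := a)) \<phi> \<longleftrightarrow> sat M (e'(v := a)) \<phi>" for a
    by (rule Ex.IH) (simp add: Ex.prems)
  then show ?case by simp
qed

lemma tm_val_in_dom:
  "is_fo_struct M \<Longrightarrow> range e \<subseteq> dom M \<Longrightarrow> tm_val M e t \<in> dom M"
proof (induction t)
  case (App f ts)
  then have "set (map (tm_val M e) ts) \<subseteq> dom M" by auto
  then show ?case using App.prems(1) unfolding is_fo_struct_def by simp
qed auto

section \<open>Ultrafilters\<close>

definition ultra :: "'b filter \<Rightarrow> bool" where
  "ultra U \<longleftrightarrow> U \<noteq> bot \<and> (\<forall>P. eventually P U \<or> eventually (\<lambda>x. \<not> P x) U)"

lemma ultra_not: "ultra U \<Longrightarrow> eventually (\<lambda>x. \<not> P x) U \<longleftrightarrow> \<not> eventually P U"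
  using eventually_conj[of P U "\<lambda>x. \<not> P x"] by (auto simp: ultra_def trivial_limit_def)

text \<open>Zorn's lemma with the order reversed: in the order on \<open>filter\<close> a finer
  filter is smaller, so ultrafilters are the minimal proper filters.\<close>

lemma ultra_below:
  assumes "F \<noteq> bot"
  obtains U where "ultra U" "U \<le> F"
proof -
  define A where "A = {G. G \<noteq> bot \<and> G \<le> F}"
  have "\<exists>m \<in> A. \<forall>G \<in> A. m \<ge> G \<longrightarrow> G = m"
  proof (rule predicate_Zorn)
    show "partial_order_on A (relation_of (\<ge>) A)"
      by (auto simp: partial_order_on_def preorder_on_def refl_on_def trans_def antisym_def
          relation_of_def)
    fix C assume C: "C \<in> Chains (relation_of (\<ge>) A)"
    then have CA: "C \<subseteq> A" and lin: "\<And>G H. G \<in> C \<Longrightarrow> H \<in> C \<Longrightarrow> G \<le> H \<or> H \<le> G"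
      unfolding Chains_def relation_of_def by blast+
    show "\<exists>u \<in> A. \<forall>G \<in> C. u \<le> G"
    proof (cases "C = {}")
      case True
      then show ?thesis using assms A_def by blast
    next
      case False
      \<comment> \<open>A chain is downward directed, so what holds eventually for its infimum
        already holds eventually for one of its members. Hence the infimum stays proper.\<close>
      have "eventually (\<lambda>_. False) (Inf C) \<longleftrightarrow> (\<exists>G \<in> C. eventually (\<lambda>_. False) G)"
      proof (rule eventually_Inf_base[OF False])
        fix G H assume "G \<in> C" "H \<in> C"
        then show "\<exists>x \<in> C. x \<le> inf G H"
          using lin[of G H] by (metis inf_absorb1 inf_absorb2 order_refl)
      qed
      moreover have "\<not> eventually (\<lambda>_. False) G" if "G \<in> C" for G
        using that CA by (auto simp: A_def trivial_limit_def)
      ultimately have "Inf C \<noteq> bot"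
        by (auto simp: trivial_limit_def)
      moreover have "Inf C \<le> F"
        using False CA by (auto simp: A_def intro: Inf_lower2)
      ultimately show ?thesis by (auto simp: A_def intro: Inf_lower)
    qed
  qed
  then obtain U where U: "U \<in> A" and min: "\<And>G. G \<in> A \<Longrightarrow> G \<le> U \<Longrightarrow> G = U" by blast
  have "eventually P U" if "\<not> eventually (\<lambda>x. \<not> P x) U" for P
  proof -
    \<comment> \<open>Refining \<open>U\<close> by a set whose complement is not in \<open>U\<close>
      leaves it proper; minimality then forces the set into \<open>U\<close>.\<close>
    have "inf U (principal {x. P x}) \<in> A"
      using U that by (auto simp: A_def trivial_limit_def eventually_inf_principal intro: le_infI1)
    then have "inf U (principal {x. P x}) = U" by (rule min) simp
    moreover have "eventually P (inf U (principal {x. P x}))"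
      by (simp add: eventually_inf_principal)
    ultimately show ?thesis by simp
  qed
  then show thesis using U that by (auto simp: A_def ultra_def)
qed

section \<open>Ultrapowers and Los's theorem\<close>

text \<open>The elements of the ultrapower are canonical representatives of the classes of sequences, so
  that no quotient type is needed.\<close>

definition ultra_rep :: "'b filter \<Rightarrow> 'a set \<Rightarrow> ('b \<Rightarrow> 'a) \<Rightarrow> 'b \<Rightarrow> 'a" where
  "ultra_rep U D f = (SOME g. range g \<subseteq> D \<and> eventually (\<lambda>n. g n = f n) U)"

lemma ultra_rep:
  assumes "range f \<subseteq> D"
  shows "range (ultra_rep U D f) \<subseteq> D" "eventually (\<lambda>n. ultra_rep U D f n = f n) U"
proof -
  have "range (ultra_rep U D f) \<subseteq> D \<and> eventually (\<lambda>n. ultra_rep U D f n = f n) U"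
    unfolding ultra_rep_def by (rule someI[of _ f]) (simp add: assms)
  then show "range (ultra_rep U D f) \<subseteq> D" "eventually (\<lambda>n. ultra_rep U D f n = f n) U"
    by auto
qed

text \<open>Equivalent sequences have the same set of candidates, from which \<open>SOME\<close>
  picks the same representative. Equality of representatives can thus stand for equality of
  classes.\<close>

lemma ultra_rep_eq_iff:
  assumes "range f \<subseteq> D" "range g \<subseteq> D"
  shows "ultra_rep U D f = ultra_rep U D g \<longleftrightarrow> eventually (\<lambda>n. f n = g n) U"
proof
  assume "ultra_rep U D f = ultra_rep U D g"
  then show "eventually (\<lambda>n. f n = g n) U"
    using eventually_conj[OF ultra_rep(2)[OF assms(1), of U] ultra_rep(2)[OF assms(2), of U]]
    by (auto elim: eventually_mono)
next
  assume fg: "eventually (\<lambda>n. f n = g n) U"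
  have "eventually (\<lambda>n. h n = f n) U \<longleftrightarrow> eventually (\<lambda>n. h n = g n) U" for h
    by (rule eventually_subst[OF eventually_mono[OF fg]]) auto
  then show "ultra_rep U D f = ultra_rep U D g"
    unfolding ultra_rep_def by simp
qed

definition ultrapower ::
  "'b filter \<Rightarrow> ('f, 'r, 'a) fo_struct \<Rightarrow> ('f, 'r, 'b \<Rightarrow> 'a) fo_struct" where
  "ultrapower U M =
     \<lparr>dom = ultra_rep U (dom M) ` {f. range f \<subseteq> dom M},
      funs = (\<lambda>s xs. ultra_rep U (dom M) (\<lambda>n. funs M s (map (\<lambda>x. x n) xs))),
      rels = (\<lambda>r xs. eventually (\<lambda>n. rels M r (map (\<lambda>x. x n) xs)) U)\<rparr>"

context
  fixes M :: "('f, 'r, 'a) fo_struct" and U :: "'b filter"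
  assumes M: "is_fo_struct M" and U: "ultra U"
begin

lemma ultrapower_elem: "x \<in> dom (ultrapower U M) \<Longrightarrow> x n \<in> dom M"
  using ultra_rep(1)[of _ "dom M" U] by (force simp: ultrapower_def)

lemma ultrapower_elemE:
  assumes "x \<in> dom (ultrapower U M)"
  obtains f where "range f \<subseteq> dom M" "x = ultra_rep U (dom M) f"
  using assms that by (auto simp: ultrapower_def)

lemma ultra_rep_in_ultrapower:
  "range f \<subseteq> dom M \<Longrightarrow> ultra_rep U (dom M) f \<in> dom (ultrapower U M)"
  unfolding ultrapower_def by simp

lemma is_fo_struct_ultrapower: "is_fo_struct (ultrapower U M)"
  unfolding is_fo_struct_def
proof (intro conjI allI impI)
  show "dom (ultrapower U M) \<noteq> {}"
    using M unfolding is_fo_struct_def ultrapower_def by auto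
  fix f xs assume "set xs \<subseteq> dom (ultrapower U M)"
  then have "\<And>n. set (map (\<lambda>x. x n) xs) \<subseteq> dom M"
    using ultrapower_elem by auto
  then have "range (\<lambda>n. funs M f (map (\<lambda>x. x n) xs)) \<subseteq> dom M"
    using M unfolding is_fo_struct_def by auto
  then show "funs (ultrapower U M) f xs \<in> dom (ultrapower U M)"
    unfolding ultrapower_def by simp
qed

text \<open>Coordinatewise evaluation is claimed only almost everywhere, because
  \<open>ultra_rep\<close> may alter a sequence off a set in \<open>U\<close>. Each application adds
  finitely many such conditions, one for its value and one for each argument.\<close>

lemma tm_val_ultrapower:
  assumes "\<And>k. range (e k) \<subseteq> dom M"
  shows "eventually (\<lambda>n. tm_val (ultrapower U M) (\<lambda>k. ultra_rep U (dom M) (e k)) t n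
                        = tm_val M (\<lambda>k. e k n) t) U"
    (is "eventually (\<lambda>n. tm_val ?N ?e t n = _) U")
proof (induction t)
  case (Var v)
  then show ?case using ultra_rep(2)[OF assms] by simp
next
  case (App f ts)
  have dom: "tm_val ?N ?e t \<in> dom ?N" for t
    using assms by (intro tm_val_in_dom is_fo_struct_ultrapower) (auto intro: ultra_rep_in_ultrapower)
  let ?g = "\<lambda>n. funs M f (map (\<lambda>x. x n) (map (tm_val ?N ?e) ts))"
  have "set (map (\<lambda>x. x n) (map (tm_val ?N ?e) ts)) \<subseteq> dom M" for n
    using dom ultrapower_elem by auto
  then have "range ?g \<subseteq> dom M"
    using M unfolding is_fo_struct_def by auto
  then have "eventually (\<lambda>n. ultra_rep U (dom M) ?g n = ?g n) U" by (rule ultra_rep(2))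
  moreover have "eventually (\<lambda>n. \<forall>t \<in> set ts. tm_val ?N ?e t n = tm_val M (\<lambda>k. e k n) t) U"
    using App by (intro eventually_ball_finite) auto
  ultimately show ?case
  proof eventually_elim
    case (elim n)
    then have "map (\<lambda>x. x n) (map (tm_val ?N ?e) ts) = map (tm_val M (\<lambda>k. e k n)) ts"
      by auto
    moreover have "tm_val ?N ?e (App f ts) = ultra_rep U (dom M) ?g"
      by (simp add: ultrapower_def)
    ultimately show ?case using elim(1) by (simp only: tm_val.simps)
  qed
qed

text \<open>Los's theorem. The ultrafilter property enters through negation, choice of witnesses
  through the quantifier.\<close>

lemma sat_ultrapower:
  assumes "\<And>k. range (e k) \<subseteq> dom M"
  shows "sat (ultrapower U M) (\<lambda>k. ultra_rep U (dom M) (e k)) \<phi>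
         \<longleftrightarrow> eventually (\<lambda>n. sat M (\<lambda>k. e k n) \<phi>) U"
  using assms
proof (induction \<phi> arbitrary: e)
  case (Eq s t)
  let ?N = "ultrapower U M" and ?e = "\<lambda>k. ultra_rep U (dom M) (e k)"
  have "tm_val ?N ?e t \<in> dom ?N" for t
    using Eq by (intro tm_val_in_dom is_fo_struct_ultrapower) (auto intro: ultra_rep_in_ultrapower)
  then have "\<exists>f. range f \<subseteq> dom M \<and> tm_val ?N ?e t = ultra_rep U (dom M) f" for t
    by (metis ultrapower_elemE)
  then obtain f where f: "\<And>t. range (f t) \<subseteq> dom M" "\<And>t. tm_val ?N ?e t = ultra_rep U (dom M) (f t)"
    by metis
  have "eventually (\<lambda>n. f t n = tm_val M (\<lambda>k. e k n) t) U" for t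
    using eventually_conj[OF tm_val_ultrapower[of e t, OF Eq] ultra_rep(2)[OF f(1)[of t], of U]]
    unfolding f(2) by (auto elim: eventually_mono)
  note ev = this[of s] this[of t]
  have "eventually (\<lambda>n. f s n = f t n) U
        \<longleftrightarrow> eventually (\<lambda>n. tm_val M (\<lambda>k. e k n) s = tm_val M (\<lambda>k. e k n) t) U"
    using eventually_conj[OF ev] by (intro eventually_subst) (auto elim: eventually_mono)
  then show ?case using f by (simp add: ultra_rep_eq_iff)
next
  case (Rel r ts)
  let ?N = "ultrapower U M" and ?e = "\<lambda>k. ultra_rep U (dom M) (e k)"
  have "eventually (\<lambda>n. \<forall>t \<in> set ts. tm_val ?N ?e t n = tm_val M (\<lambda>k. e k n) t) U"
    using tm_val_ultrapower[of e, OF Rel] by (intro eventually_ball_finite) auto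
  then have "eventually (\<lambda>n. rels M r (map (\<lambda>x. x n) (map (tm_val ?N ?e) ts))) U
             \<longleftrightarrow> eventually (\<lambda>n. rels M r (map (tm_val M (\<lambda>k. e k n)) ts)) U"
  proof (intro eventually_subst, eventually_elim)
    case (elim n)
    then have "map (\<lambda>x. x n) (map (tm_val ?N ?e) ts) = map (tm_val M (\<lambda>k. e k n)) ts"
      by auto
    then show ?case by (simp only:)
  qed
  moreover have "rels ?N r xs \<longleftrightarrow> eventually (\<lambda>n. rels M r (map (\<lambda>x. x n) xs)) U" for xs
    by (simp add: ultrapower_def)
  ultimately show ?case by (simp only: sat.simps)
next
  case (Neg \<phi>)
  then show ?case by (simp add: ultra_not[OF U])
next
  case (Conj \<phi> \<psi>)
  then show ?case by (simp add: eventually_conj_iff)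
next
  case (Ex v \<phi>)
  let ?r = "ultra_rep U (dom M)"
  have upd: "sat (ultrapower U M) ((\<lambda>k. ?r (e k))(v := ?r f)) \<phi>
        \<longleftrightarrow> eventually (\<lambda>n. sat M ((\<lambda>k. e k n)(v := f n)) \<phi>) U" if "range f \<subseteq> dom M" for f
  proof -
    have "(\<lambda>k. ?r (e k))(v := ?r f) = (\<lambda>k. ?r ((e(v := f)) k))"
      "\<And>n. (\<lambda>k. e k n)(v := f n) = (\<lambda>k. (e(v := f)) k n)"
      by auto
    then show ?thesis using Ex.IH[of "e(v := f)"] Ex.prems that by simp
  qed
  have "sat (ultrapower U M) (\<lambda>k. ?r (e k)) (Ex v \<phi>)
        \<longleftrightarrow> (\<exists>f. range f \<subseteq> dom M \<and> sat (ultrapower U M) ((\<lambda>k. ?r (e k))(v := ?r f)) \<phi>)"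
    by (auto simp: ultrapower_def)
  also have "\<dots> \<longleftrightarrow> (\<exists>f. range f \<subseteq> dom M \<and> eventually (\<lambda>n. sat M ((\<lambda>k. e k n)(v := f n)) \<phi>) U)"
    using upd by blast
  also have "\<dots> \<longleftrightarrow> eventually (\<lambda>n. \<exists>a \<in> dom M. sat M ((\<lambda>k. e k n)(v := a)) \<phi>) U"
  proof
    assume "\<exists>f. range f \<subseteq> dom M \<and> eventually (\<lambda>n. sat M ((\<lambda>k. e k n)(v := f n)) \<phi>) U"
    then show "eventually (\<lambda>n. \<exists>a \<in> dom M. sat M ((\<lambda>k. e k n)(v := a)) \<phi>) U"
      by (auto elim!: eventually_mono)
  next
    assume ev: "eventually (\<lambda>n. \<exists>a \<in> dom M. sat M ((\<lambda>k. e k n)(v := a)) \<phi>) U"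
    \<comment> \<open>A witness is chosen in each coordinate, and an arbitrary element of the domain
      where none exists, so that \<open>f\<close> is total.\<close>
    have "\<exists>a \<in> dom M. (\<exists>a \<in> dom M. sat M ((\<lambda>k. e k n)(v := a)) \<phi>) \<longrightarrow>
            sat M ((\<lambda>k. e k n)(v := a)) \<phi>" for n
      using M unfolding is_fo_struct_def by blast
    then obtain f where f: "\<And>n. f n \<in> dom M"
        "\<And>n. \<exists>a \<in> dom M. sat M ((\<lambda>k. e k n)(v := a)) \<phi> \<Longrightarrow> sat M ((\<lambda>k. e k n)(v := f n)) \<phi>"
      by metis
    then have "eventually (\<lambda>n. sat M ((\<lambda>k. e k n)(v := f n)) \<phi>) U"
      by (intro eventually_mono[OF ev]) blast
    with f(1) show "\<exists>f. range f \<subseteq> dom M \<and> eventually (\<lambda>n. sat M ((\<lambda>k. e k n)(v := f n)) \<phi>) U"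
      by blast
  qed
  finally show ?case by simp
qed

lemma ultrapower_is_model: "is_model (ultrapower U M) (Th M)"
  unfolding is_model_def
proof (intro conjI ballI is_fo_struct_ultrapower)
  fix \<phi> assume "\<phi> \<in> Th M"
  then have \<phi>: "holds M \<phi>" by (simp add: Th_def)
  show "holds (ultrapower U M) \<phi>"
    unfolding holds_def
  proof (intro allI impI)
    fix e :: "nat \<Rightarrow> 'b \<Rightarrow> 'a" assume "range e \<subseteq> dom (ultrapower U M)"
    then have "\<exists>f. range f \<subseteq> dom M \<and> e k = ultra_rep U (dom M) f" for k :: nat
      using ultrapower_elemE[of "e k"] by (metis range_subsetD)
    then obtain f :: "nat \<Rightarrow> 'b \<Rightarrow> 'a"
      where f: "\<And>k. range (f k) \<subseteq> dom M" "\<And>k. e k = ultra_rep U (dom M) (f k)"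
      by metis
    have e: "e = (\<lambda>k. ultra_rep U (dom M) (f k))" using f(2) by auto
    have "sat M (\<lambda>k. f k n) \<phi>" for n
    proof -
      have "range (\<lambda>k. f k n) \<subseteq> dom M" using f(1) by auto
      then show ?thesis using \<phi> unfolding holds_def by blast
    qed
    then show "sat (ultrapower U M) e \<phi>" unfolding e using sat_ultrapower[OF f(1)] by simp
  qed
qed

end

section \<open>Coding syntax in the type of symbols\<close>

text \<open>Terms, formulas and Skolem terms are encoded as trees to bound their number.\<close>

datatype 'x tree = Node 'x "'x tree list"

text \<open>\<open>p\<close> acts as an injective pairing, and the distinct elements
  \<open>u\<close> and \<open>v\<close> mark empty and nonempty lists.\<close>

primrec list_code :: "('x \<times> 'x \<Rightarrow> 'x) \<Rightarrow> 'x \<Rightarrow> 'x \<Rightarrow> 'x list \<Rightarrow> 'x" where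
  "list_code p u v [] = p (u, u)"
| "list_code p u v (x # xs) = p (v, p (x, list_code p u v xs))"

primrec tree_code :: "('x \<times> 'x \<Rightarrow> 'x) \<Rightarrow> 'x \<Rightarrow> 'x \<Rightarrow> 'x tree \<Rightarrow> 'x" where
  "tree_code p u v (Node x ts) = p (x, list_code p u v (map (tree_code p u v) ts))"

lemma list_code_inject:
  assumes "inj p" "u \<noteq> v"
  shows "list_code p u v xs = list_code p u v ys \<Longrightarrow> xs = ys"
proof (induction xs arbitrary: ys)
  case Nil
  then show ?case using assms by (cases ys) (auto dest: injD)
next
  case (Cons x xs)
  then show ?case using assms by (cases ys) (auto dest!: injD[OF assms(1)])
qed

lemma tree_code_inject:
  assumes "inj p" "u \<noteq> v"
  shows "tree_code p u v t = tree_code p u v t' \<Longrightarrow> t = t'"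
proof (induction t arbitrary: t')
  case (Node x ts)
  obtain y us where t': "t' = Node y us" by (cases t')
  have "x = y" and eq: "map (tree_code p u v) ts = map (tree_code p u v) us"
    using Node.prems list_code_inject[OF assms] unfolding t' by (auto dest!: injD[OF assms(1)])
  have "ts = us"
  proof (rule nth_equalityI)
    show len: "length ts = length us" using eq by (rule map_eq_imp_length_eq)
    fix i assume "i < length ts"
    then show "ts ! i = us ! i"
      using Node.IH[of "ts ! i"] len arg_cong[OF eq, of "\<lambda>l. l ! i"] by simp
  qed
  with \<open>x = y\<close> t' show ?case by simp
qed

text \<open>An infinite set is equinumerous with its square, which supplies the pairing; any two
  distinct elements supply the tags.\<close>

lemma inj_tree_exists:
  assumes "infinite (UNIV :: 'x set)"
  shows "\<exists>c :: 'x tree \<Rightarrow> 'x. inj c"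
proof -
  have "\<exists>p. bij_betw p (UNIV \<times> UNIV :: ('x \<times> 'x) set) (UNIV :: 'x set)"
    using card_of_Times_same_infinite[OF assms] by (simp add: card_of_ordIso)
  then obtain p :: "'x \<times> 'x \<Rightarrow> 'x" where p: "inj p" by (auto simp: bij_betw_def)
  obtain u v :: 'x where "u \<noteq> v"
    using assms by (metis (full_types) UNIV_eq_I finite.emptyI finite_insert insertCI)
  then have "inj (tree_code p u v)" using tree_code_inject[OF p] by (auto intro: injI)
  then show ?thesis by blast
qed

primrec tm_tree :: "'f tm \<Rightarrow> ('f + 'r + nat) tree" where
  "tm_tree (Var v) = Node (Inr (Inr v)) []"
| "tm_tree (App f ts) = Node (Inl f) (map tm_tree ts)"

lemma map_eq_mapD:
  assumes "map f xs = map f ys" "\<And>x y. x \<in> set xs \<Longrightarrow> f x = f y \<Longrightarrow> x = y"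
  shows "xs = ys"
proof (rule nth_equalityI)
  show len: "length xs = length ys" using assms(1) by (rule map_eq_imp_length_eq)
  fix i assume "i < length xs"
  then show "xs ! i = ys ! i"
    using assms(2)[of "xs ! i" "ys ! i"] len arg_cong[OF assms(1), of "\<lambda>l. l ! i"] by simp
qed

lemma tm_tree_inject: "tm_tree t = tm_tree t' \<Longrightarrow> t = t'"
proof (induction t arbitrary: t')
  case (Var v)
  then show ?case by (cases t') auto
next
  case (App f ts)
  then show ?case by (cases t') (auto intro: map_eq_mapD)
qed

text \<open>The labels 0, 1 and 2 belong to \<open>Eq\<close>, \<open>Neg\<close> and
  \<open>Conj\<close>; the variable bound by \<open>Ex\<close> is shifted by 3 to avoid
  them.\<close>

primrec fm_tree :: "('f, 'r) fm \<Rightarrow> ('f + 'r + nat) tree" where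
  "fm_tree (Eq s t) = Node (Inr (Inr 0)) [tm_tree s, tm_tree t]"
| "fm_tree (Rel r ts) = Node (Inr (Inl r)) (map tm_tree ts)"
| "fm_tree (Neg \<phi>) = Node (Inr (Inr 1)) [fm_tree \<phi>]"
| "fm_tree (Conj \<phi> \<psi>) = Node (Inr (Inr 2)) [fm_tree \<phi>, fm_tree \<psi>]"
| "fm_tree (Ex v \<phi>) = Node (Inr (Inr (v + 3))) [fm_tree \<phi>]"

lemma fm_tree_inject: "fm_tree \<phi> = fm_tree \<phi>' \<Longrightarrow> \<phi> = \<phi>'"
proof (induction \<phi> arbitrary: \<phi>')
  case (Eq s t)
  then show ?case by (cases \<phi>') (auto dest: tm_tree_inject)
next
  case (Rel r ts)
  then show ?case by (cases \<phi>') (auto intro: map_eq_mapD dest: tm_tree_inject)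
next
  case (Neg \<phi>)
  then show ?case by (cases \<phi>') auto
next
  case (Conj \<phi> \<psi>)
  then show ?case by (cases \<phi>') auto
next
  case (Ex v \<phi>)
  then show ?case by (cases \<phi>') auto
qed

section \<open>Skolem hulls and the downward Loewenheim-Skolem theorem\<close>

text \<open>Names for the elements of the Skolem hull of a countable set.\<close>

datatype ('f, 'r) skolem =
    Seed nat
  | Fun 'f "('f, 'r) skolem list"
  | Wit nat "('f, 'r) fm" "('f, 'r) skolem list"

text \<open>\<open>Seed\<close> and \<open>Wit\<close> share their labels but differ in the number
  of children: a \<open>Wit\<close> node always has its formula as a child.\<close>

primrec skolem_tree :: "('f, 'r) skolem \<Rightarrow> ('f + 'r + nat) tree" where
  "skolem_tree (Seed n) = Node (Inr (Inr n)) []"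
| "skolem_tree (Fun f ss) = Node (Inl f) (map skolem_tree ss)"
| "skolem_tree (Wit v \<phi> ss) = Node (Inr (Inr v)) (fm_tree \<phi> # map skolem_tree ss)"

lemma skolem_tree_inject: "skolem_tree s = skolem_tree s' \<Longrightarrow> s = s'"
proof (induction s arbitrary: s')
  case (Seed n)
  then show ?case by (cases s') auto
next
  case (Fun f ss)
  then show ?case by (cases s') (auto intro: map_eq_mapD)
next
  case (Wit v \<phi> ss)
  then show ?case by (cases s') (auto intro: map_eq_mapD dest: fm_tree_inject)
qed

definition list_env :: "'a \<Rightarrow> 'a list \<Rightarrow> nat \<Rightarrow> 'a" where
  "list_env d xs k = (if k < length xs then xs ! k else d)"

text \<open>The implication inside \<open>SOME\<close> makes the choice an element of a nonempty
  domain even when the formula has no witness.\<close>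

definition witness :: "('f, 'r, 'a) fo_struct \<Rightarrow> (nat \<Rightarrow> 'a) \<Rightarrow> nat \<Rightarrow> ('f, 'r) fm \<Rightarrow> 'a" where
  "witness N e v \<phi> = (SOME a. a \<in> dom N \<and>
     ((\<exists>a \<in> dom N. sat N (e(v := a)) \<phi>) \<longrightarrow> sat N (e(v := a)) \<phi>))"

primrec skolem_val :: "('f, 'r, 'a) fo_struct \<Rightarrow> (nat \<Rightarrow> 'a) \<Rightarrow> ('f, 'r) skolem \<Rightarrow> 'a" where
  "skolem_val N s (Seed n) = s n"
| "skolem_val N s (Fun f ss) = funs N f (map (skolem_val N s) ss)"
| "skolem_val N s (Wit v \<phi> ss) = witness N (list_env (s 0) (map (skolem_val N s) ss)) v \<phi>"

lemma witness:
  assumes "is_fo_struct N"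
  shows "witness N e v \<phi> \<in> dom N"
    "\<exists>a \<in> dom N. sat N (e(v := a)) \<phi> \<Longrightarrow> sat N (e(v := witness N e v \<phi>)) \<phi>"
proof -
  have "\<exists>a. a \<in> dom N \<and> ((\<exists>a \<in> dom N. sat N (e(v := a)) \<phi>) \<longrightarrow> sat N (e(v := a)) \<phi>)"
    using assms unfolding is_fo_struct_def by blast
  from someI_ex[OF this]
  show "witness N e v \<phi> \<in> dom N"
    "\<exists>a \<in> dom N. sat N (e(v := a)) \<phi> \<Longrightarrow> sat N (e(v := witness N e v \<phi>)) \<phi>"
    unfolding witness_def by blast+
qed

lemma skolem_val_in_dom:
  assumes "is_fo_struct N" "range s \<subseteq> dom N"
  shows "skolem_val N s w \<in> dom N"
proof (induction w)
  case (Seed n)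
  then show ?case using assms(2) by auto
next
  case (Fun f ss)
  then have "set (map (skolem_val N s) ss) \<subseteq> dom N" by auto
  then show ?case using assms(1) unfolding is_fo_struct_def by simp
next
  case (Wit v \<phi> ss)
  then show ?case using witness(1)[OF assms(1)] by simp
qed

definition skolem_hull :: "('f, 'r, 'a) fo_struct \<Rightarrow> (nat \<Rightarrow> 'a) \<Rightarrow> 'a set" where
  "skolem_hull N s = range (skolem_val N s)"

lemma hull_funs_closed:
  assumes "set xs \<subseteq> skolem_hull N s"
  shows "funs N f xs \<in> skolem_hull N s"
proof -
  have "\<exists>ws. xs = map (skolem_val N s) ws"
    using assms by (induction xs) (auto simp: skolem_hull_def intro: exI[of _ "_ # _"])
  then obtain ws where "xs = map (skolem_val N s) ws" by blast
  then have "funs N f xs = skolem_val N s (Fun f ws)" by simp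
  then show ?thesis unfolding skolem_hull_def by blast
qed

text \<open>The Tarski-Vaught criterion. Only finitely many values of \<open>e\<close> matter to the
  formula; they are named by Skolem terms, and \<open>Wit\<close> applied to these names is a
  witness.\<close>

lemma hull_witness:
  assumes N: "is_fo_struct N" and e: "range e \<subseteq> skolem_hull N s"
    and ex: "\<exists>a \<in> dom N. sat N (e(v := a)) \<phi>"
  shows "\<exists>a \<in> skolem_hull N s. sat N (e(v := a)) \<phi>"
proof -
  obtain n where n: "\<And>k. k \<in> fm_vars \<phi> \<Longrightarrow> k < n"
    using finite_fm_vars[of \<phi>] unfolding finite_nat_set_iff_bounded by blast
  have "\<And>k. \<exists>w. e k = skolem_val N s w" using e by (auto simp: skolem_hull_def)
  then obtain w where w: "\<And>k. e k = skolem_val N s (w k)" by metis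
  let ?e = "list_env (s 0) (map (skolem_val N s) (map w [0..<n]))"
  have cong: "sat N (?e(v := a)) \<phi> \<longleftrightarrow> sat N (e(v := a)) \<phi>" for a
    using n by (intro sat_cong) (auto simp: list_env_def w)
  let ?a = "witness N ?e v \<phi>"
  have "sat N (?e(v := ?a)) \<phi>"
    by (rule witness(2)[OF N]) (use ex cong in blast)
  moreover have "?a = skolem_val N s (Wit v \<phi> (map w [0..<n]))"
    by simp
  ultimately show ?thesis
    unfolding cong skolem_hull_def by blast
qed

text \<open>\<open>N'\<close> is a copy of the Skolem hull of the seeds \<open>s\<close>, in which
  each element is replaced by the code of a Skolem term naming it. \<open>d\<close> is decoding, an
  elementary embedding into \<open>N\<close>.\<close>

lemma loewenheim_skolem:
  fixes N :: "('f, 'r, 'a) fo_struct" and s :: "nat \<Rightarrow> 'a"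
  assumes N: "is_fo_struct N" and s: "range s \<subseteq> dom N"
  obtains N' :: "('f, 'r, 'f + 'r + nat) fo_struct" and d
  where "is_fo_struct N'" "d ` dom N' \<subseteq> dom N" "range s \<subseteq> d ` dom N'"
    "\<And>e \<phi>. range e \<subseteq> dom N' \<Longrightarrow> sat N' e \<phi> \<longleftrightarrow> sat N (d \<circ> e) \<phi>"
proof -
  have "infinite (UNIV :: ('f + 'r + nat) set)" by (simp add: infinite_UNIV_char_0)
  then obtain c :: "('f + 'r + nat) tree \<Rightarrow> 'f + 'r + nat" where c: "inj c"
    using inj_tree_exists by blast
  have "\<exists>w :: ('f, 'r) skolem. skolem_val N s w = h" if "h \<in> skolem_hull N s" for h
    using that by (auto simp: skolem_hull_def)
  then obtain w :: "'a \<Rightarrow> ('f, 'r) skolem" where w: "\<And>h. h \<in> skolem_hull N s \<Longrightarrow> skolem_val N s (w h) = h" by metis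
  define g where "g h = c (skolem_tree (w h))" for h
  have "inj_on g (skolem_hull N s)"
  proof (rule inj_onI)
    fix x y assume xy: "x \<in> skolem_hull N s" "y \<in> skolem_hull N s" "g x = g y"
    then have "w x = w y" unfolding g_def using c skolem_tree_inject by (metis injD)
    then show "x = y" using w xy by metis
  qed
  define d where "d = inv_into (skolem_hull N s) g"
  have dg: "d (g h) = h" if "h \<in> skolem_hull N s" for h
    unfolding d_def using \<open>inj_on g (skolem_hull N s)\<close> that by simp
  have hull_dom: "skolem_hull N s \<subseteq> dom N"
    using skolem_val_in_dom[OF N s] by (auto simp: skolem_hull_def)
  have "s n = skolem_val N s (Seed n)" for n by simp
  then have seeds: "range s \<subseteq> skolem_hull N s" unfolding skolem_hull_def by blast
  define N' :: "('f, 'r, 'f + 'r + nat) fo_struct" where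
    "N' = \<lparr>dom = g ` skolem_hull N s, funs = (\<lambda>f xs. g (funs N f (map d xs))),
           rels = (\<lambda>r xs. rels N r (map d xs))\<rparr>"
  have d_dom: "d ` dom N' = skolem_hull N s"
    using dg by (force simp: N'_def)
  have N'_struct: "is_fo_struct N'"
    unfolding is_fo_struct_def
  proof (intro conjI allI impI)
    show "dom N' \<noteq> {}" using seeds by (auto simp: N'_def)
    fix f xs assume "set xs \<subseteq> dom N'"
    then have "set (map d xs) \<subseteq> skolem_hull N s" using d_dom by auto
    then show "funs N' f xs \<in> dom N'"
      using hull_funs_closed[of "map d xs" N s f] by (simp add: N'_def)
  qed
  have tm: "d (tm_val N' e t) = tm_val N (d \<circ> e) t" if "range e \<subseteq> dom N'" for e t
  proof (induction t)
    case (App f ts)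
    have "tm_val N' e t \<in> dom N'" for t by (rule tm_val_in_dom[OF N'_struct that])
    then have "set (map d (map (tm_val N' e) ts)) \<subseteq> skolem_hull N s" using d_dom by auto
    then have "d (tm_val N' e (App f ts)) = funs N f (map d (map (tm_val N' e) ts))"
      using dg[OF hull_funs_closed] by (simp add: N'_def)
    also have "map d (map (tm_val N' e) ts) = map (tm_val N (d \<circ> e)) ts"
      using App by (simp add: comp_def)
    finally show ?case by (simp only: tm_val.simps)
  qed auto
  have sat: "sat N' e \<phi> \<longleftrightarrow> sat N (d \<circ> e) \<phi>" if "range e \<subseteq> dom N'" for e \<phi>
    using that
  proof (induction \<phi> arbitrary: e)
    case (Eq t u)
    have "inj_on d (dom N')" using dg by (force simp: N'_def intro: inj_onI)
    then show ?case
      using tm[OF Eq] tm_val_in_dom[OF N'_struct Eq] by (metis inj_onD sat.simps(1))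
  next
    case (Rel r ts)
    have "map d (map (tm_val N' e) ts) = map (tm_val N (d \<circ> e)) ts"
      using tm[OF Rel] by simp
    moreover have "rels N' r xs \<longleftrightarrow> rels N r (map d xs)" for xs by (simp add: N'_def)
    ultimately show ?case by (simp only: sat.simps)
  next
    case (Ex v \<phi>)
    have upd: "sat N' (e(v := a)) \<phi> \<longleftrightarrow> sat N ((d \<circ> e)(v := d a)) \<phi>" if "a \<in> dom N'" for a
    proof -
      have "d \<circ> e(v := a) = (d \<circ> e)(v := d a)" by auto
      moreover have "range (e(v := a)) \<subseteq> dom N'" using Ex.prems that by auto
      ultimately show ?thesis using Ex.IH by metis
    qed
    have "sat N' e (Ex v \<phi>) \<longleftrightarrow> (\<exists>a \<in> dom N'. sat N ((d \<circ> e)(v := d a)) \<phi>)"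
      using upd by auto
    also have "\<dots> \<longleftrightarrow> (\<exists>a \<in> skolem_hull N s. sat N ((d \<circ> e)(v := a)) \<phi>)"
      unfolding d_dom[symmetric] by blast
    \<comment> \<open>Moving a witness from \<open>dom N\<close> into the hull is
      \<open>hull_witness\<close>; the converse is inclusion.\<close>
    also have "\<dots> \<longleftrightarrow> (\<exists>a \<in> dom N. sat N ((d \<circ> e)(v := a)) \<phi>)"
      using hull_witness[OF N, of "d \<circ> e" s v \<phi>] hull_dom Ex.prems d_dom by fastforce
    finally show ?case by (simp only: sat.simps)
  qed auto
  show thesis
    using that[OF N'_struct _ _ sat] d_dom hull_dom seeds by blast
qed

section \<open>From finite patterns to ict-patterns\<close>

definition finite_ict_pattern ::
  "('f, 'r, 'a) fo_struct \<Rightarrow> nat \<Rightarrow> (nat \<Rightarrow> ('f, 'r) fm) \<Rightarrow> nat \<Rightarrow> (nat \<Rightarrow> nat \<Rightarrow> nat \<Rightarrow> 'a) \<Rightarrow> bool"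
  where
  "finite_ict_pattern M d \<phi> n b \<longleftrightarrow>
     (\<forall>i<d. \<forall>j<n. range (b i j) \<subseteq> dom M) \<and>
     (\<forall>\<eta>. (\<forall>i<d. \<eta> i < n) \<longrightarrow> (\<exists>a \<in> dom M. \<forall>i<d. \<forall>j<n.
        sat M (case_nat a (b i j)) (\<phi> i) \<longleftrightarrow> j = \<eta> i))"

text \<open>Compactness by an ultrapower: entry \<open>(i, j)\<close> of the limit is the class of
  the entries \<open>(i, j)\<close> of the \<open>n\<close>-th patterns. These exist once
  \<open>n > j\<close>, hence almost everywhere, since \<open>U\<close> refines
  \<open>sequentially\<close>.\<close>

lemma ict_pattern_in_ultrapower:
  fixes M :: "('f, 'r, 'a) fo_struct"
  assumes M: "is_fo_struct M" and fin: "\<And>n. finite_ict_pattern M d \<phi> n (b n)"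
    and U: "ultra U" "U \<le> sequentially"
  shows "\<exists>b'. ict_pattern (ultrapower U M) d \<phi> b'"
proof -
  obtain z where z: "z \<in> dom M" using M by (auto simp: is_fo_struct_def)
  let ?N = "ultrapower U M" and ?r = "ultra_rep U (dom M)"
  \<comment> \<open>\<open>z\<close> fills the coordinates \<open>n\<close> in which column
    \<open>j\<close> does not yet exist.\<close>
  define \<beta> where "\<beta> i j k n = (if i < d \<and> j < n then b n i j k else z)" for i j k n
  have \<beta>: "range (\<beta> i j k) \<subseteq> dom M" for i j k
  proof -
    have "b n i j k \<in> dom M" if "i < d" "j < n" for n
      using fin[of n] that unfolding finite_ict_pattern_def by blast
    then show ?thesis using z by (auto simp: \<beta>_def)
  qed
  have large: "eventually (\<lambda>n. n > m) U" for m
    using U(2) eventually_gt_at_top filter_leD by blast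
  define b' where "b' i j k = ?r (\<beta> i j k)" for i j k
  have "\<exists>a \<in> dom ?N. \<forall>i<d. \<forall>j. sat ?N (case_nat a (b' i j)) (\<phi> i) \<longleftrightarrow> j = \<eta> i" for \<eta> :: "nat \<Rightarrow> nat"
  proof -
    \<comment> \<open>The \<open>n\<close>-th pattern realizes \<open>\<eta>\<close> only if
      \<open>n\<close> exceeds its first \<open>d\<close> values; for the finitely many other
      \<open>n\<close> any element will do.\<close>
    have "\<exists>a \<in> dom M. (\<forall>i<d. \<eta> i < n) \<longrightarrow>
            (\<forall>i<d. \<forall>j<n. sat M (case_nat a (b n i j)) (\<phi> i) \<longleftrightarrow> j = \<eta> i)" for n
      using fin[of n] z unfolding finite_ict_pattern_def by blast
    then obtain a where a: "\<And>n. a n \<in> dom M" and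
      real: "\<And>n i j. (\<forall>i<d. \<eta> i < n) \<Longrightarrow> i < d \<Longrightarrow> j < n \<Longrightarrow>
               sat M (case_nat (a n) (b n i j)) (\<phi> i) \<longleftrightarrow> j = \<eta> i"
      by metis
    have "sat ?N (case_nat (?r a) (b' i j)) (\<phi> i) \<longleftrightarrow> j = \<eta> i" if "i < d" for i j
    proof -
      have ran: "range (case_nat a (\<beta> i j) k) \<subseteq> dom M" for k
        using a \<beta> by (cases k) auto
      have "case_nat (?r a) (b' i j) = (\<lambda>k. ?r (case_nat a (\<beta> i j) k))"
        by (auto simp: b'_def split: nat.split)
      then have "sat ?N (case_nat (?r a) (b' i j)) (\<phi> i) \<longleftrightarrow>
            eventually (\<lambda>n. sat M (\<lambda>k. case_nat a (\<beta> i j) k n) (\<phi> i)) U"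
        using sat_ultrapower[OF M U(1), of "case_nat a (\<beta> i j)" "\<phi> i"] ran by simp
      also have "\<dots> \<longleftrightarrow> eventually (\<lambda>n. j = \<eta> i) U"
      proof (rule eventually_subst)
        have "eventually (\<lambda>n. \<forall>i \<in> {..<d}. n > \<eta> i) U"
          using large by (intro eventually_ball_finite) auto
        then show "eventually (\<lambda>n. sat M (\<lambda>k. case_nat a (\<beta> i j) k n) (\<phi> i) = (j = \<eta> i)) U"
          using large[of j]
        proof eventually_elim
          case (elim n)
          then have "(\<lambda>k. case_nat a (\<beta> i j) k n) = case_nat (a n) (b n i j)"
            using that by (auto simp: \<beta>_def split: nat.split)
          then show ?case using real[of n i j] elim that by simp
        qed
      qed
      also have "\<dots> \<longleftrightarrow> j = \<eta> i"
        using U(1) by (simp add: ultra_def eventually_const)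
      finally show ?thesis .
    qed
    moreover have "?r a \<in> dom ?N"
      using a by (intro ultra_rep_in_ultrapower[OF M U(1)]) auto
    ultimately show ?thesis by blast
  qed
  moreover have "range (b' i j) \<subseteq> dom ?N" for i j
    using \<beta> ultra_rep_in_ultrapower[OF M U(1)] by (auto simp: b'_def)
  ultimately show ?thesis unfolding ict_pattern_def by blast
qed

text \<open>The parameters and one realization for each choice of columns form a countable set. Its
  Skolem hull still carries the pattern and has a copy in the type over which
  \<open>has_ict_pattern\<close> ranges.\<close>

lemma has_ict_pattern_if_ict_pattern:
  fixes N :: "('f, 'r, 'a) fo_struct"
  assumes N: "is_model N T" and pat: "ict_pattern N d \<phi> b"
  shows "has_ict_pattern T d"
proof -
  have Ns: "is_fo_struct N" using N by (simp add: is_model_def)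
  then obtain z where z: "z \<in> dom N" by (auto simp: is_fo_struct_def)
  \<comment> \<open>Only the first \<open>d\<close> values of \<open>\<eta>\<close> matter, so
    lists, of which there are countably many, can index the realizations.\<close>
  define ext :: "nat list \<Rightarrow> nat \<Rightarrow> nat" where "ext l i = (if i < d then l ! i else 0)" for l i
  have "\<exists>a \<in> dom N. \<forall>i<d. \<forall>j. sat N (case_nat a (b i j)) (\<phi> i) \<longleftrightarrow> j = ext l i" for l
    using pat unfolding ict_pattern_def by blast
  then obtain a where a: "\<And>l. a l \<in> dom N"
      "\<And>l i j. i < d \<Longrightarrow> sat N (case_nat (a l) (b i j)) (\<phi> i) \<longleftrightarrow> j = ext l i"
    by metis
  \<comment> \<open>One sequence enumerates all realizations and all parameters, by way of a
    countable sum type.\<close>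
  define s where "s n = (case from_nat n :: nat list + nat \<times> nat \<times> nat of
      Inl l \<Rightarrow> a l | Inr (i, j, k) \<Rightarrow> if i < d then b i j k else z)" for n
  have s: "range s \<subseteq> dom N"
    using a(1) z pat by (force simp: s_def ict_pattern_def split: sum.split prod.split)
  have sa: "a l = s (to_nat (Inl l :: nat list + nat \<times> nat \<times> nat))" for l
    by (simp add: s_def)
  have sb: "b i j k = s (to_nat (Inr (i, j, k) :: nat list + nat \<times> nat \<times> nat))" if "i < d" for i j k
    using that by (simp add: s_def)
  obtain N' :: "('f, 'r, 'f + 'r + nat) fo_struct" and h
    where N': "is_fo_struct N'" "h ` dom N' \<subseteq> dom N" "range s \<subseteq> h ` dom N'"
      "\<And>e \<phi>. range e \<subseteq> dom N' \<Longrightarrow> sat N' e \<phi> \<longleftrightarrow> sat N (h \<circ> e) \<phi>"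
    using loewenheim_skolem[OF Ns s] by blast
  have "\<exists>x \<in> dom N'. h x = s n" for n using N'(3) by (metis imageE range_subsetD)
  then obtain g where g: "\<And>n. g n \<in> dom N'" "\<And>n. h (g n) = s n" by metis
  define a' where "a' l = g (to_nat (Inl l :: nat list + nat \<times> nat \<times> nat))" for l
  define b' where "b' i j k = g (to_nat (Inr (i, j, k) :: nat list + nat \<times> nat \<times> nat))" for i j k
  have sat: "sat N' (case_nat (a' l) (b' i j)) (\<phi> i) \<longleftrightarrow> j = ext l i" if "i < d" for l i j
  proof -
    have "h \<circ> case_nat (a' l) (b' i j) = case_nat (a l) (b i j)"
      using sa sb[OF that] by (auto simp: a'_def b'_def g split: nat.split)
    moreover have "range (case_nat (a' l) (b' i j)) \<subseteq> dom N'"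
      using g by (auto simp: a'_def b'_def split: nat.splits)
    ultimately show ?thesis using N'(4) a(2)[OF that] by metis
  qed
  have "\<exists>x \<in> dom N'. \<forall>i<d. \<forall>j. sat N' (case_nat x (b' i j)) (\<phi> i) \<longleftrightarrow> j = \<eta> i" for \<eta>
  proof (intro bexI allI impI)
    show "a' (map \<eta> [0..<d]) \<in> dom N'" by (simp add: a'_def g)
    show "sat N' (case_nat (a' (map \<eta> [0..<d])) (b' i j)) (\<phi> i) \<longleftrightarrow> j = \<eta> i" if "i < d" for i j
      using sat[OF that] that by (simp add: ext_def)
  qed
  then have "ict_pattern N' d \<phi> b'"
    unfolding ict_pattern_def using g(1) by (auto simp: b'_def)
  moreover have "is_model N' T"
    unfolding is_model_def
  proof (intro conjI ballI N'(1))
    fix \<psi> assume "\<psi> \<in> T"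
    then have "holds N \<psi>" using N by (simp add: is_model_def)
    show "holds N' \<psi>"
      unfolding holds_def
    proof (intro allI impI)
      fix e :: "nat \<Rightarrow> 'f + 'r + nat" assume e: "range e \<subseteq> dom N'"
      then have "range (h \<circ> e) \<subseteq> dom N" using N'(2) by auto
      then show "sat N' e \<psi>" using \<open>holds N \<psi>\<close> N'(4)[OF e] unfolding holds_def by blast
    qed
  qed
  ultimately show ?thesis unfolding has_ict_pattern_def by blast
qed

text \<open>With \<open>\<phi>\<close> fixed, finite patterns of every width would yield an
  ict-pattern of depth \<open>d\<close> in a model of \<open>Th M\<close>, so the dp-rank would be
  at least 2.\<close>

theorem dp_minimal_pattern_bound:
  assumes M: "is_fo_struct M" "dp_minimal M" and "d \<ge> 2"
  shows "\<exists>n. \<forall>b. \<not> finite_ict_pattern M d \<phi> n b"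
proof (rule ccontr)
  assume "\<not> ?thesis"
  then obtain b where b: "\<And>n. finite_ict_pattern M d \<phi> n (b n)" by metis
  obtain U :: "nat filter" where U: "ultra U" "U \<le> sequentially"
    using ultra_below[of sequentially] by auto
  obtain b' where "ict_pattern (ultrapower U M) d \<phi> b'"
    using ict_pattern_in_ultrapower[OF M(1) b U] by blast
  then have "has_ict_pattern (Th M) d"
    using has_ict_pattern_if_ict_pattern[OF ultrapower_is_model[OF M(1) U(1)]] by blast
  then have "enat d \<le> dp_rank (Th M)"
    unfolding dp_rank_def by (intro SUP_upper) simp
  with M(2) \<open>d \<ge> 2\<close> show False
    by (simp add: dp_minimal_def one_enat_def)
qed

section \<open>Indices of additive subgroups\<close>

text \<open>Sending \<open>f x\<close> to \<open>g x\<close> is well defined and injective. This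
  compares the numbers of cosets of different subgroups.\<close>

lemma card_image_cong_ker:
  assumes "\<And>x y. x \<in> A \<Longrightarrow> y \<in> A \<Longrightarrow> f x = f y \<longleftrightarrow> g x = g y"
  shows "card (f ` A) = card (g ` A)"
proof (rule bij_betw_same_card)
  have "g (inv_into A f (f x)) = g x" if "x \<in> A" for x
    using assms[of "inv_into A f (f x)" x] that by (simp add: f_inv_into_f inv_into_into)
  then show "bij_betw (\<lambda>z. g (inv_into A f z)) (f ` A) (g ` A)"
    unfolding bij_betw_def inj_on_def using assms by (auto simp: image_image)
qed

text \<open>The index of \<open>A \<inter> L\<close> in \<open>A\<close>, where \<open>0\<close> stands for an infinite index; it is thus
  multiplicative in towers without finiteness assumptions.\<close>

definition index :: "('a, 'm) ring_scheme \<Rightarrow> 'a set \<Rightarrow> 'a set \<Rightarrow> nat" where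
  "index G A L = card ((\<lambda>x. L +>\<^bsub>G\<^esub> x) ` A)"

lemma index_mono:
  assumes "H \<subseteq> A" "index G A L \<noteq> 0"
  shows "index G H L \<le> index G A L" "H \<noteq> {} \<Longrightarrow> index G H L \<noteq> 0"
proof -
  have fin: "finite ((\<lambda>x. L +>\<^bsub>G\<^esub> x) ` A)"
    using assms(2) by (simp add: index_def card_eq_0_iff)
  moreover have sub: "(\<lambda>x. L +>\<^bsub>G\<^esub> x) ` H \<subseteq> (\<lambda>x. L +>\<^bsub>G\<^esub> x) ` A" using assms(1) by blast
  ultimately show "index G H L \<le> index G A L" by (simp add: index_def card_mono)
  show "H \<noteq> {} \<Longrightarrow> index G H L \<noteq> 0"
    using finite_subset[OF sub fin] by (simp add: index_def card_eq_0_iff)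
qed

context abelian_group
begin

lemma coset_eq_iff:
  assumes "additive_subgroup L G" "x \<in> carrier G" "y \<in> carrier G"
  shows "L +> x = L +> y \<longleftrightarrow> x \<ominus> y \<in> L"
proof
  interpret L: additive_subgroup L G by fact
  assume "L +> x = L +> y"
  moreover have "x = \<zero> \<oplus> x" using assms by simp
  ultimately have "x \<in> L +> y"
    unfolding a_r_coset_def' using L.zero_closed by blast
  then obtain l where "l \<in> L" "x = l \<oplus> y" unfolding a_r_coset_def' by blast
  moreover have "l \<oplus> y \<ominus> y = l"
    using L.a_Hcarr[OF \<open>l \<in> L\<close>] assms by (simp add: minus_eq a_assoc r_neg)
  ultimately show "x \<ominus> y \<in> L" by simp
next
  interpret L: additive_subgroup L G by fact
  assume xy: "x \<ominus> y \<in> L"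
  have "x \<ominus> y \<oplus> y = x" using assms by (simp add: minus_eq a_assoc l_neg)
  have "L +> x = L +> (x \<ominus> y \<oplus> y)" using \<open>x \<ominus> y \<oplus> y = x\<close> by simp
  also have "\<dots> = L +> (x \<ominus> y) +> y"
    using assms by (simp add: a_coset_add_assoc L.a_subset)
  also have "L +> (x \<ominus> y) = L"
    using xy assms by (intro a_coset_join2) (auto simp: L.a_subgroup)
  finally show "L +> x = L +> y" .
qed

lemma additive_subgroup_Int:
  assumes "additive_subgroup A G" "additive_subgroup B G"
  shows "additive_subgroup (A \<inter> B) G"
  using add.subgroups_Inter_pair[of A B] assms by (simp add: additive_subgroup_def)

lemma additive_subgroup_minus:
  assumes "additive_subgroup A G" "x \<in> A" "y \<in> A"
  shows "x \<ominus> y \<in> A"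
  using assms by (simp add: minus_eq additive_subgroup.a_closed additive_subgroup.a_inv_closed)

lemma add_mem_iff:
  assumes "additive_subgroup A G" "y \<in> A" "x \<in> carrier G"
  shows "x \<oplus> y \<in> A \<longleftrightarrow> x \<in> A"
proof
  interpret A: additive_subgroup A G by fact
  assume "x \<oplus> y \<in> A"
  then have "x \<oplus> y \<ominus> y \<in> A" by (rule additive_subgroup_minus[OF assms(1) _ assms(2)])
  then show "x \<in> A" using A.a_Hcarr[OF assms(2)] assms(3) by (simp add: minus_eq a_assoc r_neg)
next
  assume "x \<in> A"
  then show "x \<oplus> y \<in> A" using assms(2) by (rule additive_subgroup.a_closed[OF assms(1)])
qed

text \<open>Sums of representatives \<open>T\<close> of the cosets of \<open>B\<close> met by
  \<open>A\<close> and \<open>S\<close> of the cosets of \<open>C\<close> met by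
  \<open>A \<inter> B\<close> represent each coset of \<open>B \<inter> C\<close> met by
  \<open>A\<close> exactly once. Infinite indices are covered, as \<open>card\<close> of a product
  is multiplicative with \<open>0\<close> for infinite sets.\<close>

lemma index_tower:
  assumes A: "additive_subgroup A G" and B: "additive_subgroup B G" and C: "additive_subgroup C G"
  shows "index G A (B \<inter> C) = index G A B * index G (A \<inter> B) C"
proof -
  obtain T where T: "T \<subseteq> A" "inj_on (\<lambda>x. B +> x) T" "(\<lambda>x. B +> x) ` A = (\<lambda>x. B +> x) ` T"
    using iffD1[OF subset_image_inj, of "(\<lambda>x. B +> x) ` A" "\<lambda>x. B +> x" A] that by auto
  obtain S where S: "S \<subseteq> A \<inter> B" "inj_on (\<lambda>x. C +> x) S"
      "(\<lambda>x. C +> x) ` (A \<inter> B) = (\<lambda>x. C +> x) ` S"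
    using iffD1[OF subset_image_inj, of "(\<lambda>x. C +> x) ` (A \<inter> B)" "\<lambda>x. C +> x" "A \<inter> B"] that by auto
  note BC = additive_subgroup_Int[OF B C]
  have cA: "A \<subseteq> carrier G" by (rule additive_subgroup.a_subset[OF A])
  have cT: "t \<in> carrier G" if "t \<in> T" for t using that T(1) cA by blast
  have cS: "s \<in> carrier G" if "s \<in> S" for s using that S(1) cA by blast
  let ?f = "\<lambda>(t, s). (B \<inter> C) +> (t \<oplus> s)"
  have inj: "inj_on ?f (T \<times> S)"
  proof (rule inj_onI, clarify)
    fix t s t' s' assume ts: "t \<in> T" "s \<in> S" "t' \<in> T" "s' \<in> S"
      and eq: "(B \<inter> C) +> (t \<oplus> s) = (B \<inter> C) +> (t' \<oplus> s')"
    have d: "t \<oplus> s \<ominus> (t' \<oplus> s') \<in> B \<inter> C"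
      using eq coset_eq_iff[OF BC] ts cT cS by simp
    have sB: "s \<ominus> s' \<in> B" using S(1) ts additive_subgroup_minus[OF B] by blast
    \<comment> \<open>Both differences on the right lie in \<open>B\<close>, so the
      \<open>T\<close>-parts agree; the remaining difference of \<open>S\<close>-parts then lies in
      \<open>C\<close>.\<close>
    have "t \<ominus> t' = (t \<oplus> s \<ominus> (t' \<oplus> s')) \<ominus> (s \<ominus> s')"
      using ts cT cS by (simp add: minus_eq minus_add a_ac r_neg1 r_neg2 l_neg r_neg)
        (simp add: a_lcomm[of s t] r_neg2)
    then have "t \<ominus> t' \<in> B" using d sB additive_subgroup_minus[OF B] by auto
    then have t: "t = t'" using coset_eq_iff[OF B] ts cT inj_onD[OF T(2)] by simp
    have "s \<ominus> s' = t \<oplus> s \<ominus> (t \<oplus> s')"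
      using ts cT cS by (simp add: minus_eq minus_add a_ac r_neg1 r_neg2 l_neg r_neg)
    then have "s \<ominus> s' \<in> C" using d t by simp
    then have "s = s'" using coset_eq_iff[OF C] ts cS inj_onD[OF S(2)] by simp
    with t show "t = t' \<and> s = s'" by simp
  qed
  have img: "?f ` (T \<times> S) = (\<lambda>x. (B \<inter> C) +> x) ` A"
  proof (intro equalityI subsetI)
    fix X assume "X \<in> ?f ` (T \<times> S)"
    then obtain t s where "t \<in> T" "s \<in> S" "X = (B \<inter> C) +> (t \<oplus> s)" by auto
    then show "X \<in> (\<lambda>x. (B \<inter> C) +> x) ` A"
      using T(1) S(1) additive_subgroup.a_closed[OF A] by blast
  next
    fix X assume "X \<in> (\<lambda>x. (B \<inter> C) +> x) ` A"
    then obtain x where x: "x \<in> A" "X = (B \<inter> C) +> x" by blast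
    then obtain t where t: "t \<in> T" "B +> x = B +> t" using T(3) by blast
    have cx: "x \<in> carrier G" and ct: "t \<in> carrier G" using x(1) cA cT[OF t(1)] by auto
    \<comment> \<open>Once \<open>t\<close> is removed, the remainder lies in
      \<open>A \<inter> B\<close>, where \<open>S\<close> represents every coset of
      \<open>C\<close>.\<close>
    have xt: "x \<ominus> t \<in> A" "x \<ominus> t \<in> B"
      using coset_eq_iff[OF B cx ct] t x(1) T(1) additive_subgroup_minus[OF A] by auto
    then obtain s where s: "s \<in> S" "C +> (x \<ominus> t) = C +> s" using S(3) by blast
    have cs: "s \<in> carrier G" "s \<in> B" using S(1) s(1) cS by auto
    have "x \<ominus> t \<ominus> s \<in> C"
      using coset_eq_iff[OF C minus_closed[OF cx ct] cs(1)] s(2) by simp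
    moreover have "x \<ominus> t \<ominus> s \<in> B"
      using additive_subgroup_minus[OF B xt(2) cs(2)] .
    moreover have "x \<ominus> t \<ominus> s = x \<ominus> (t \<oplus> s)"
      using cx ct cs(1) by (simp add: minus_eq minus_add a_assoc)
    ultimately have "X = (B \<inter> C) +> (t \<oplus> s)"
      using coset_eq_iff[OF BC cx, of "t \<oplus> s"] ct cs(1) x(2) by simp
    then show "X \<in> ?f ` (T \<times> S)" using t s by auto
  qed
  have "index G A (B \<inter> C) = card (T \<times> S)"
    unfolding index_def img[symmetric] using inj by (rule card_image)
  also have "\<dots> = index G A B * index G (A \<inter> B) C"
    unfolding index_def T(3) S(3) using T(2) S(2) by (simp add: card_cartesian_product card_image)
  finally show ?thesis .
qed

lemma additive_subgroup_nonempty: "additive_subgroup A G \<Longrightarrow> A \<noteq> {}"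
  using additive_subgroup.zero_closed[of A G] by auto

text \<open>The index of \<open>A \<inter> B \<inter> C\<close> in \<open>A\<close> is computed
  through \<open>B\<close>, where both factors are finite, and through \<open>C\<close>, where
  \<open>index G A C\<close> is a factor.\<close>

lemma index_nonzero_trans:
  assumes A: "additive_subgroup A G" and B: "additive_subgroup B G" and C: "additive_subgroup C G"
    and "index G A B \<noteq> 0" "index G B C \<noteq> 0"
  shows "index G A C \<noteq> 0"
proof -
  have "index G (A \<inter> B) C \<noteq> 0"
    using index_mono(2)[of "A \<inter> B" B G C] assms(5)
      additive_subgroup_nonempty[OF additive_subgroup_Int[OF A B]] by simp
  then have "index G A (B \<inter> C) \<noteq> 0" using assms(4) by (simp add: index_tower[OF A B C])
  moreover have "index G A (B \<inter> C) = index G A C * index G (A \<inter> C) B"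
    by (subst Int_commute) (rule index_tower[OF A C B])
  ultimately show ?thesis by simp
qed

lemma index_eq_1_imp_subset:
  assumes A: "additive_subgroup A G" and L: "additive_subgroup L G" and "index G A L = 1"
  shows "A \<subseteq> L"
proof
  fix x assume x: "x \<in> A"
  obtain X where "(\<lambda>x. L +> x) ` A = {X}" using assms(3) by (auto simp: index_def card_1_singleton_iff)
  then have "L +> x = L +> \<zero>" using x additive_subgroup.zero_closed[OF A] by blast
  then have "x \<ominus> \<zero> \<in> L"
    using x coset_eq_iff[OF L] additive_subgroup.a_Hcarr[OF A] by simp
  moreover have "\<ominus> \<zero> = \<zero>" using r_neg[of \<zero>] by simp
  ultimately show "x \<in> L"
    using x additive_subgroup.a_Hcarr[OF A] by (simp add: minus_eq)
qed

section \<open>Comparing subgroups by their indices\<close>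

text \<open>For commensurable subgroups this says that \<open>A\<close> is no larger than
  \<open>B\<close>. The value \<open>0\<close> in the disjunction means that
  \<open>A \<inter> B\<close> has infinite index in \<open>B\<close>.\<close>

definition index_le :: "'a set \<Rightarrow> 'a set \<Rightarrow> bool" where
  "index_le A B \<longleftrightarrow> index G A B \<noteq> 0 \<and> (index G B A = 0 \<or> index G A B \<le> index G B A)"

text \<open>In the commensurable case, the indices of \<open>A \<inter> B \<inter> C\<close> in
  \<open>A\<close>, \<open>B\<close> and \<open>C\<close> increase in this order; each is a product
  in two ways by \<open>index_tower\<close>.\<close>

lemma index_le_trans:
  assumes A: "additive_subgroup A G" and B: "additive_subgroup B G" and C: "additive_subgroup C G"
    and AB: "index_le A B" and BC: "index_le B C"
  shows "index_le A C"
proof (cases "index G C A = 0")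
  case True
  then show ?thesis
    using index_nonzero_trans[OF A B C] AB BC by (simp add: index_le_def)
next
  case False
  have nz: "index G A B \<noteq> 0" "index G B C \<noteq> 0" using AB BC by (auto simp: index_le_def)
  then have "index G B A \<noteq> 0" "index G C B \<noteq> 0" "index G A C \<noteq> 0"
    using index_nonzero_trans A B C False by blast+
  then have le: "index G A B \<le> index G B A" "index G B C \<le> index G C B"
    using AB BC by (auto simp: index_le_def)
  have A1: "index G A (B \<inter> C) = index G A B * index G (A \<inter> B) C"
    by (rule index_tower[OF A B C])
  have B1: "index G B (C \<inter> A) = index G B A * index G (A \<inter> B) C"
    using index_tower[OF B A C] by (simp add: Int_commute)
  have B2: "index G B (C \<inter> A) = index G B C * index G (B \<inter> C) A"
    by (rule index_tower[OF B C A])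
  have C1: "index G C (A \<inter> B) = index G C B * index G (B \<inter> C) A"
    using index_tower[OF C B A] by (simp add: Int_commute)
  have A2: "index G A (B \<inter> C) = index G A C * index G (C \<inter> A) B"
    using index_tower[OF A C B] by (simp add: Int_commute)
  have C2: "index G C (A \<inter> B) = index G C A * index G (C \<inter> A) B"
    by (rule index_tower[OF C A B])
  \<comment> \<open>The two sides are the indices of the triple intersection in \<open>A\<close> and
    in \<open>C\<close>, compared through its index in \<open>B\<close>. The common factor is
    nonzero and cancels.\<close>
  have "index G A C * index G (C \<inter> A) B \<le> index G C A * index G (C \<inter> A) B"
    unfolding A2[symmetric] C2[symmetric] C1
    using A1 B1 B2 le by (metis mult_le_mono1 order_trans)
  moreover have "index G (C \<inter> A) B \<noteq> 0"
    using index_mono(2)[of "C \<inter> A" A G B] nz(1)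
      additive_subgroup_nonempty[OF additive_subgroup_Int[OF C A]] by simp
  ultimately show ?thesis using \<open>index G A C \<noteq> 0\<close> by (simp add: index_le_def)
qed

section \<open>Independent families and the Baldwin-Saxl argument\<close>

lemma additive_subgroup_Int_Inter:
  assumes "additive_subgroup A G" "\<And>i. i \<in> F \<Longrightarrow> additive_subgroup (D i) G"
  shows "additive_subgroup (A \<inter> (\<Inter>i\<in>F. D i)) G"
proof (cases "F = {}")
  case False
  then have "subgroup (\<Inter>(D ` F)) (add_monoid G)"
    using assms(2) by (intro add.subgroups_Inter) (auto simp: additive_subgroup_def)
  then show ?thesis using additive_subgroup_Int assms(1) by (simp add: additive_subgroup_def)
qed (use assms in simp)

text \<open>Irredundancy of the intersection within \<open>A\<close>: omitting any one member
  enlarges it.\<close>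

definition subgroup_independent :: "'a set \<Rightarrow> ('i \<Rightarrow> 'a set) \<Rightarrow> 'i set \<Rightarrow> bool" where
  "subgroup_independent A D F \<longleftrightarrow>
     (\<forall>i\<in>F. \<exists>x\<in>A. x \<notin> D i \<and> (\<forall>j\<in>F - {i}. x \<in> D j))"

text \<open>Among the subfamilies with the same intersection, one of least size is
  irredundant.\<close>

lemma subgroup_independent_core:
  assumes "finite F"
  obtains F' where "F' \<subseteq> F" "subgroup_independent A D F'"
    "A \<inter> (\<Inter>i\<in>F'. D i) = A \<inter> (\<Inter>i\<in>F. D i)"
proof -
  let ?P = "\<lambda>F'. F' \<subseteq> F \<and> A \<inter> (\<Inter>i\<in>F'. D i) = A \<inter> (\<Inter>i\<in>F. D i)"
  obtain F' where F': "?P F'" and min: "\<And>E. ?P E \<Longrightarrow> card F' \<le> card E"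
    using ex_has_least_nat[of ?P F card] by blast
  have "subgroup_independent A D F'"
    unfolding subgroup_independent_def
  proof
    fix i assume i: "i \<in> F'"
    have "finite F'" using F' assms finite_subset by blast
    then have "card (F' - {i}) < card F'" using i by (intro card_Diff1_less)
    then have "\<not> ?P (F' - {i})" using min by (meson leD)
    moreover have "A \<inter> (\<Inter>i\<in>F'. D i) = A \<inter> (\<Inter>i\<in>F' - {i}. D i) \<inter> D i" using i by auto
    ultimately have "A \<inter> (\<Inter>i\<in>F' - {i}. D i) \<inter> D i \<noteq> A \<inter> (\<Inter>i\<in>F' - {i}. D i)"
      using F' by auto
    then show "\<exists>x\<in>A. x \<notin> D i \<and> (\<forall>j\<in>F' - {i}. x \<in> D j)" by auto
  qed
  then show thesis using that F' by blast
qed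

text \<open>A finite intersection equals that of an independent subfamily, which has fewer than
  \<open>n\<close> members of index at most \<open>k\<close>. So the indices of finite intersections
  are bounded, and one of greatest index lies in every \<open>D i\<close>.\<close>

lemma baldwin_saxl_finite_index:
  assumes A: "additive_subgroup A G" and D: "\<And>i. i \<in> S \<Longrightarrow> additive_subgroup (D i) G"
    and bounded: "\<And>i. i \<in> S \<Longrightarrow> index G A (D i) \<noteq> 0 \<and> index G A (D i) \<le> k"
    and indep: "\<And>F. F \<subseteq> S \<Longrightarrow> finite F \<Longrightarrow> card F = n \<Longrightarrow> \<not> subgroup_independent A D F"
  obtains F where "finite F" "F \<subseteq> S" "A \<inter> (\<Inter>i\<in>F. D i) = A \<inter> (\<Inter>i\<in>S. D i)"
    "index G A (A \<inter> (\<Inter>i\<in>S. D i)) \<noteq> 0"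
proof -
  define H where "H F = A \<inter> (\<Inter>i\<in>F. D i)" for F
  have H: "additive_subgroup (H F) G" if "F \<subseteq> S" for F
    unfolding H_def using that D by (intro additive_subgroup_Int_Inter A) auto
  have H_insert: "index G A (H (insert i F)) = index G A (H F) * index G (H F) (D i)"
    if "i \<in> S" "F \<subseteq> S" for i F
  proof -
    have "H (insert i F) = H F \<inter> D i" "A \<inter> H F = H F" by (auto simp: H_def)
    then show ?thesis using index_tower[OF A H[OF that(2)] D[OF that(1)]] by simp
  qed
  have step: "index G (H F) (D i) \<noteq> 0 \<and> index G (H F) (D i) \<le> k" if "i \<in> S" "F \<subseteq> S" for i F
    using index_mono[of "H F" A G "D i"] bounded[OF that(1)]
      additive_subgroup_nonempty[OF H[OF that(2)]] by (auto simp: H_def)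
  \<comment> \<open>The base is \<open>Suc k\<close> because powers are monotone in the exponent
    only for a base of at least 1.\<close>
  have card_bound: "index G A (H F) \<noteq> 0 \<and> index G A (H F) \<le> Suc k ^ card F"
    if "finite F" "F \<subseteq> S" for F
    using that
  proof (induction F)
    case empty
    have "A +> x = A" if "x \<in> A" for x
      using that A additive_subgroup.a_Hcarr[OF A] by (intro a_coset_join2) (auto simp: additive_subgroup_def)
    then have "(\<lambda>x. A +> x) ` A = {A}" using additive_subgroup_nonempty[OF A] by auto
    then show ?case by (simp add: H_def index_def)
  next
    case (insert i F)
    then show ?case
      using step[of i F] mult_le_mono[of "index G (H F) (D i)" "Suc k" "index G A (H F)" "Suc k ^ card F"]
      by (auto simp: H_insert mult.commute)
  qed
  have bound: "index G A (H F) \<le> Suc k ^ n" if F: "finite F" "F \<subseteq> S" for F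
  proof -
    obtain F' where F': "F' \<subseteq> F" "subgroup_independent A D F'" "H F' = H F"
      using subgroup_independent_core[OF F(1), of A D] unfolding H_def by blast
    have fin: "finite F'" using F'(1) F(1) finite_subset by blast
    have "card F' < n"
    proof (rule ccontr)
      assume "\<not> card F' < n"
      then obtain E where E: "E \<subseteq> F'" "card E = n" "finite E"
        using obtain_subset_with_card_n[of n F'] fin finite_subset by (metis not_less)
      \<comment> \<open>Independence passes to subfamilies, so \<open>n\<close> or more independent
        members would contain exactly \<open>n\<close>.\<close>
      then have "subgroup_independent A D E"
        using F'(2) unfolding subgroup_independent_def by blast
      with E F'(1) F(2) show False using indep by blast
    qed
    then have "Suc k ^ card F' \<le> Suc k ^ n" by (intro power_increasing) auto
    then show ?thesis using card_bound[of F'] F' fin F(2)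
      by (metis order_trans subset_trans)
  qed
  obtain F where F: "finite F \<and> F \<subseteq> S"
    and max: "\<And>E. finite E \<and> E \<subseteq> S \<Longrightarrow> index G A (H E) \<le> index G A (H F)"
    using ex_has_greatest_nat[of "\<lambda>F. finite F \<and> F \<subseteq> S" "{}" "\<lambda>F. index G A (H F)" "Suc (Suc k ^ n)"] bound
    by (auto simp: less_Suc_eq_le)
  have nz: "index G A (H F) \<noteq> 0" using card_bound F by blast
  \<comment> \<open>Adding \<open>i\<close> to \<open>F\<close> multiplies the index by
    \<open>index G (H F) (D i)\<close>; maximality forces this factor to be 1.\<close>
  have "H F \<subseteq> D i" if "i \<in> S" for i
  proof (rule index_eq_1_imp_subset[OF H D[OF that]])
    have "index G A (H F) * index G (H F) (D i) \<le> index G A (H F)"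
      using max[of "insert i F"] F that H_insert[of i F] by simp
    then show "index G (H F) (D i) = 1"
      using nz step[OF that, of F] F by (metis mult.right_neutral mult_le_cancel1 le_antisym less_one neq0_conv not_le)
  qed (use F in blast)
  then have "H F = H S" using F by (fastforce simp: H_def)
  then show thesis using that[of F] F nz by (simp add: H_def)
qed

end

section \<open>Conductors\<close>

locale field_subring = field K for K :: "('a, 'm) ring_scheme" (structure) +
  fixes R :: "'a set"
  assumes R: "subring R K"
begin

lemma R_closed:
  "x \<in> R \<Longrightarrow> x \<in> carrier K" "\<zero> \<in> R" "\<one> \<in> R"
  "x \<in> R \<Longrightarrow> y \<in> R \<Longrightarrow> x \<oplus> y \<in> R" "x \<in> R \<Longrightarrow> y \<in> R \<Longrightarrow> x \<otimes> y \<in> R"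
  "x \<in> R \<Longrightarrow> \<ominus> x \<in> R" "x \<in> R \<Longrightarrow> y \<in> R \<Longrightarrow> x \<ominus> y \<in> R"
  using subringE[OF R] by (auto simp: minus_eq)

lemma additive_subgroup_intro:
  assumes "A \<subseteq> carrier K" "\<zero> \<in> A" "\<And>x y. x \<in> A \<Longrightarrow> y \<in> A \<Longrightarrow> x \<oplus> y \<in> A"
    "\<And>x. x \<in> A \<Longrightarrow> \<ominus> x \<in> A"
  shows "additive_subgroup A K"
  unfolding additive_subgroup_def
  using assms by (intro add.subgroupI) (auto simp: a_inv_def)

lemma additive_subgroup_R: "additive_subgroup R K"
  using R_closed by (intro additive_subgroup_intro) auto

definition scale :: "'a \<Rightarrow> 'a set \<Rightarrow> 'a set" where
  "scale c A = (\<lambda>x. c \<otimes> x) ` A"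

lemma additive_subgroup_scale:
  assumes "c \<in> carrier K" "additive_subgroup A K"
  shows "additive_subgroup (scale c A) K"
proof (rule additive_subgroup_intro)
  interpret A: additive_subgroup A K by fact
  show "scale c A \<subseteq> carrier K" using assms(1) by (auto simp: scale_def)
  have "\<zero> = c \<otimes> \<zero>" using assms(1) by simp
  then show "\<zero> \<in> scale c A" unfolding scale_def using A.zero_closed by blast
  fix x assume "x \<in> scale c A"
  then obtain a where a: "a \<in> A" "x = c \<otimes> a" by (auto simp: scale_def)
  then have "\<ominus> x = c \<otimes> (\<ominus> a)" using assms(1) by (simp add: r_minus)
  then show "\<ominus> x \<in> scale c A" using a(1) A.a_inv_closed by (simp add: scale_def)
  fix y assume "y \<in> scale c A"
  then obtain b where b: "b \<in> A" "y = c \<otimes> b" by (auto simp: scale_def)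
  then have "x \<oplus> y = c \<otimes> (a \<oplus> b)" using a assms(1) by (simp add: r_distr)
  then show "x \<oplus> y \<in> scale c A" using a(1) b(1) A.a_closed by (simp add: scale_def)
qed

lemma scale_scale:
  "c \<in> carrier K \<Longrightarrow> d \<in> carrier K \<Longrightarrow> A \<subseteq> carrier K \<Longrightarrow> scale c (scale d A) = scale (c \<otimes> d) A"
  by (auto simp: scale_def image_image m_assoc subset_iff intro!: image_cong)

lemma scale_one: "A \<subseteq> carrier K \<Longrightarrow> scale \<one> A = A"
  by (auto simp: scale_def subset_iff image_iff)

lemma nonzero_mult: "c \<in> carrier K - {\<zero>} \<Longrightarrow> d \<in> carrier K - {\<zero>} \<Longrightarrow> c \<otimes> d \<in> carrier K - {\<zero>}"
  using integral by auto

lemma nonzero_inv: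
  assumes "c \<in> carrier K - {\<zero>}"
  shows "inv c \<in> carrier K - {\<zero>}" "c \<otimes> inv c = \<one>" "inv c \<otimes> c = \<one>"
proof -
  have "c \<in> Units K" using assms by (simp add: field_Units)
  then show "c \<otimes> inv c = \<one>" "inv c \<otimes> c = \<one>" "inv c \<in> carrier K - {\<zero>}"
    using Units_inv_Units[of c] by (auto simp: field_Units)
qed

lemma mem_scale_iff:
  assumes "c \<in> carrier K - {\<zero>}" "x \<in> carrier K" "A \<subseteq> carrier K"
  shows "c \<otimes> x \<in> scale c A \<longleftrightarrow> x \<in> A"
  using assms m_lcancel[of c x] by (auto simp: scale_def subset_iff)

lemma index_scale:
  assumes c: "c \<in> carrier K - {\<zero>}" and A: "additive_subgroup A K" and B: "additive_subgroup B K"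
  shows "index K (scale c A) (scale c B) = index K A B"
proof -
  have cB: "additive_subgroup (scale c B) K" using c B by (intro additive_subgroup_scale) auto
  have "index K (scale c A) (scale c B) = card ((\<lambda>x. scale c B +> (c \<otimes> x)) ` A)"
    by (simp add: index_def scale_def image_image)
  also have "\<dots> = index K A B"
    unfolding index_def
  proof (rule card_image_cong_ker)
    fix x y assume "x \<in> A" "y \<in> A"
    then have xy: "x \<in> carrier K" "y \<in> carrier K" using additive_subgroup.a_Hcarr[OF A] by auto
    have "c \<otimes> x \<ominus> c \<otimes> y = c \<otimes> (x \<ominus> y)" using xy c by (simp add: minus_eq r_distr r_minus)
    then show "scale c B +> (c \<otimes> x) = scale c B +> (c \<otimes> y) \<longleftrightarrow> B +> x = B +> y"
      using xy c mem_scale_iff[OF c _ additive_subgroup.a_subset[OF B], of "x \<ominus> y"]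
      by (simp add: coset_eq_iff[OF cB] coset_eq_iff[OF B])
  qed
  finally show ?thesis .
qed

section \<open>Conductors and the multiplicative set of shrinking elements\<close>

definition conductor :: "'a \<Rightarrow> 'a set" where
  "conductor c = {x \<in> R. x \<otimes> c \<in> R}"

lemma additive_subgroup_conductor:
  assumes "c \<in> carrier K"
  shows "additive_subgroup (conductor c) K"
  using assms R_closed
  by (intro additive_subgroup_intro) (auto simp: conductor_def l_distr l_minus)

text \<open>Multiplication by \<open>c\<close> maps \<open>R\<close> onto \<open>cR\<close>, and two
  images agree modulo \<open>R\<close> exactly when the originals agree modulo
  \<open>conductor c\<close>.\<close>

lemma index_conductor:
  assumes "c \<in> carrier K"
  shows "index K R (conductor c) = index K (scale c R) R"
proof -
  have "index K (scale c R) R = card ((\<lambda>x. R +> (c \<otimes> x)) ` R)"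
    by (simp add: index_def scale_def image_image)
  also have "\<dots> = index K R (conductor c)"
    unfolding index_def
  proof (rule card_image_cong_ker)
    fix x y assume xy: "x \<in> R" "y \<in> R"
    have "c \<otimes> x \<ominus> c \<otimes> y = (x \<ominus> y) \<otimes> c"
      using xy R_closed(1) assms by (simp add: minus_eq l_distr l_minus m_comm[of c])
    moreover have "x \<ominus> y \<in> conductor c \<longleftrightarrow> (x \<ominus> y) \<otimes> c \<in> R"
      using R_closed(7)[OF xy] by (simp add: conductor_def)
    ultimately show "R +> (c \<otimes> x) = R +> (c \<otimes> y) \<longleftrightarrow> conductor c +> x = conductor c +> y"
      using xy R_closed(1) assms
      by (simp add: coset_eq_iff[OF additive_subgroup_R]
          coset_eq_iff[OF additive_subgroup_conductor[OF assms]])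
  qed
  finally show ?thesis by simp
qed

text \<open>The set \<open>S\<close> of the outline: \<open>index K R (scale c R)\<close> is the
  index belonging to \<open>inv c\<close>, by \<open>index_scale_inv\<close>.\<close>

definition shrinking :: "'a set" where
  "shrinking = {c \<in> carrier K - {\<zero>}. index_le (scale c R) R}"

text \<open>Scaling the comparison of \<open>dR\<close> with \<open>R\<close> by \<open>c\<close>
  compares \<open>cdR\<close> with \<open>cR\<close>; transitivity through \<open>cR\<close> does
  the rest.\<close>

lemma shrinking_mult:
  assumes c: "c \<in> shrinking" and d: "d \<in> shrinking"
  shows "c \<otimes> d \<in> shrinking"
proof -
  have cd: "c \<in> carrier K - {\<zero>}" "d \<in> carrier K - {\<zero>}"
    "index_le (scale c R) R" "index_le (scale d R) R"
    using c d by (auto simp: shrinking_def)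
  note sub = additive_subgroup_R additive_subgroup_scale[OF _ additive_subgroup_R]
  have "index_le (scale c (scale d R)) (scale c R)"
    using cd(4) unfolding index_le_def
    by (simp add: index_scale[OF cd(1)] sub cd(2)[THEN DiffD1])
  then have "index_le (scale c (scale d R)) R"
    using cd sub by (intro index_le_trans[OF _ _ _ _ cd(3)] additive_subgroup_scale) auto
  then show ?thesis
    using cd nonzero_mult R_closed(1) by (simp add: shrinking_def scale_scale subset_iff)
qed

text \<open>Scaling by \<open>c\<close> carries the pair \<open>inv c R\<close>, \<open>R\<close> to
  the pair \<open>R\<close>, \<open>cR\<close>.\<close>

lemma index_scale_inv:
  assumes c: "c \<in> carrier K - {\<zero>}"
  shows "index K (scale (inv c) R) R = index K R (scale c R)"
    "index K R (scale (inv c) R) = index K (scale c R) R"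
proof -
  have sub: "additive_subgroup (scale c R) K" "additive_subgroup (scale (inv c) R) K"
    using c nonzero_inv(1)[OF c] by (auto intro: additive_subgroup_scale additive_subgroup_R)
  have "scale c (scale (inv c) R) = R"
    using c nonzero_inv[OF c] R_closed(1) by (simp add: scale_scale scale_one subset_iff)
  then show "index K (scale (inv c) R) R = index K R (scale c R)"
    "index K R (scale (inv c) R) = index K (scale c R) R"
    using index_scale[OF c sub(2) additive_subgroup_R] index_scale[OF c additive_subgroup_R sub(2)]
    by simp_all
qed

section \<open>The multiplier ring of a subgroup\<close>

definition multiplier :: "'a set \<Rightarrow> 'a set" where
  "multiplier J = {c \<in> carrier K. \<forall>x \<in> J. c \<otimes> x \<in> J}"

lemma subring_multiplier:
  assumes J: "additive_subgroup J K"
  shows "subring (multiplier J) K"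
proof (rule subringI)
  interpret J: additive_subgroup J K by fact
  show "multiplier J \<subseteq> carrier K" "\<one> \<in> multiplier J"
    by (auto simp: multiplier_def)
  fix a assume a: "a \<in> multiplier J"
  then show "\<ominus> a \<in> multiplier J" by (auto simp: multiplier_def l_minus)
  fix b assume "b \<in> multiplier J"
  with a show "a \<otimes> b \<in> multiplier J" "a \<oplus> b \<in> multiplier J"
    by (auto simp: multiplier_def l_distr m_assoc)
qed

text \<open>Negation depends on the carrier through its definition; uniqueness of inverses in the
  subring shows that the values agree.\<close>

lemma a_inv_subring:
  assumes "subring A K" "x \<in> A"
  shows "\<ominus>\<^bsub>K\<lparr>carrier := A\<rparr>\<^esub> x = \<ominus> x"
proof -
  interpret A: ring "K\<lparr>carrier := A\<rparr>" by (rule subring_is_ring[OF assms(1)])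
  have "x \<in> carrier K" "\<ominus> x \<in> A" using assms subringE(1,5)[OF assms(1)] by auto
  then show ?thesis using assms(2) A.minus_equality[of "\<ominus> x" x] by (simp add: l_neg)
qed

lemma ideal_multiplier:
  assumes J: "additive_subgroup J K" "J \<subseteq> multiplier J"
  shows "ideal J (K\<lparr>carrier := multiplier J\<rparr>)"
proof (rule idealI)
  interpret A: ring "K\<lparr>carrier := multiplier J\<rparr>"
    by (rule subring_is_ring[OF subring_multiplier[OF J(1)]])
  show "ring (K\<lparr>carrier := multiplier J\<rparr>)" ..
  note inv = a_inv_subring[OF subring_multiplier[OF J(1)]]
  show "subgroup J (add_monoid (K\<lparr>carrier := multiplier J\<rparr>))"
    using J additive_subgroup.zero_closed[OF J(1)] additive_subgroup.a_closed[OF J(1)]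
      additive_subgroup.a_inv_closed[OF J(1)] inv
    by (intro A.add.subgroupI) (auto simp: a_inv_def[symmetric] subset_iff)
  fix a x assume ax: "a \<in> J" "x \<in> carrier (K\<lparr>carrier := multiplier J\<rparr>)"
  then have "x \<otimes> a \<in> J" "a \<in> carrier K" "x \<in> carrier K"
    using additive_subgroup.a_Hcarr[OF J(1)] by (auto simp: multiplier_def)
  then show "x \<otimes>\<^bsub>K\<lparr>carrier := multiplier J\<rparr>\<^esub> a \<in> J" "a \<otimes>\<^bsub>K\<lparr>carrier := multiplier J\<rparr>\<^esub> x \<in> J"
    by (auto simp: m_comm)
qed

text \<open>Dp-minimality enters only through \<open>comparable\<close> and \<open>indep\<close>;
  the construction itself is algebra.\<close>

theorem exists_valuation_multiplier:
  assumes comparable: "\<And>c. c \<in> carrier K - {\<zero>} \<Longrightarrow>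
      index K (scale c R) R \<noteq> 0 \<and> index K (scale c R) R \<le> k \<or>
      index K R (scale c R) \<noteq> 0 \<and> index K R (scale c R) \<le> k"
    and indep: "\<And>F. F \<subseteq> carrier K - {\<zero>} \<Longrightarrow> finite F \<Longrightarrow> card F = n \<Longrightarrow>
      \<not> subgroup_independent R conductor F"
    and not_valuation: "\<not> valuation_subring R K"
  obtains F J where "finite F" "F \<subseteq> carrier K - {\<zero>}" "J = R \<inter> (\<Inter>c\<in>F. conductor c)"
    "index K R J \<noteq> 0" "additive_subgroup J K" "R \<subseteq> multiplier J"
    "valuation_subring (multiplier J) K" "\<one> \<notin> J"
proof -
  have S_carrier: "shrinking \<subseteq> carrier K - {\<zero>}" by (auto simp: shrinking_def)
  \<comment> \<open>At least one of the two indices is finite, and inverting \<open>c\<close>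
    exchanges them.\<close>
  have S_total: "c \<in> shrinking \<or> inv c \<in> shrinking" if "c \<in> carrier K - {\<zero>}" for c
    using comparable[OF that] that nonzero_inv(1)[OF that] index_scale_inv[OF that]
    by (auto simp: shrinking_def index_le_def)
  \<comment> \<open>If \<open>comparable\<close> bounds the other index by \<open>k\<close>, the
    index of \<open>cR\<close> is bounded too, being the smaller one.\<close>
  have S_bounded: "index K R (conductor c) \<noteq> 0 \<and> index K R (conductor c) \<le> k" if "c \<in> shrinking" for c
    using that comparable[of c] index_conductor[of c] by (auto simp: shrinking_def index_le_def)
  have subD: "additive_subgroup (conductor c) K" if "c \<in> shrinking" for c
    using that by (intro additive_subgroup_conductor) (auto simp: shrinking_def)
  obtain F where F: "finite F" "F \<subseteq> shrinking"
      "R \<inter> (\<Inter>c\<in>F. conductor c) = R \<inter> (\<Inter>c\<in>shrinking. conductor c)"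
      "index K R (R \<inter> (\<Inter>c\<in>shrinking. conductor c)) \<noteq> 0"
    using baldwin_saxl_finite_index[where S = shrinking and D = conductor and n = n,
        OF additive_subgroup_R subD S_bounded] indep S_carrier
    by (metis subset_trans)
  define J where "J = R \<inter> (\<Inter>c\<in>shrinking. conductor c)"
  have J_iff: "x \<in> J \<longleftrightarrow> x \<in> R \<and> (\<forall>c \<in> shrinking. x \<otimes> c \<in> R)" for x
    by (auto simp: J_def conductor_def)
  have J: "additive_subgroup J K"
    unfolding J_def using subD by (intro additive_subgroup_Int_Inter additive_subgroup_R)
  have R_mult: "R \<subseteq> multiplier J"
    using R_closed S_carrier by (auto simp: multiplier_def J_iff m_assoc)
  \<comment> \<open>For \<open>x\<close> in \<open>J\<close> and \<open>d\<close> in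
    \<open>shrinking\<close>, the product \<open>(c x) d = x (c d)\<close> lies in \<open>R\<close>
    because \<open>shrinking\<close> contains \<open>c d\<close>.\<close>
  have S_mult: "shrinking \<subseteq> multiplier J"
  proof
    fix c assume c: "c \<in> shrinking"
    then have cc: "c \<in> carrier K" using S_carrier by blast
    have "c \<otimes> x \<in> J" if x: "x \<in> J" for x
    proof -
      have xc: "x \<in> carrier K" using x R_closed(1) by (simp add: J_iff)
      have "c \<otimes> x \<otimes> d \<in> R" if d: "d \<in> shrinking" for d
      proof -
        have "x \<otimes> (c \<otimes> d) \<in> R" using x shrinking_mult[OF c d] by (simp add: J_iff)
        moreover have "c \<otimes> x \<otimes> d = x \<otimes> (c \<otimes> d)"
          using cc xc d S_carrier by (simp add: m_ac subset_iff)
        ultimately show ?thesis by simp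
      qed
      moreover have "c \<otimes> x \<in> R" using x c cc xc m_comm[of c x] by (simp add: J_iff)
      ultimately show ?thesis by (simp add: J_iff)
    qed
    with cc show "c \<in> multiplier J" by (simp add: multiplier_def)
  qed
  have val: "valuation_subring (multiplier J) K"
    unfolding valuation_subring_def using subring_multiplier[OF J] S_total S_mult by blast
  \<comment> \<open>If \<open>J\<close> contained 1, all of \<open>shrinking\<close> would lie in
    \<open>R\<close>, making \<open>R\<close> a valuation ring.\<close>
  have "\<one> \<notin> J"
  proof
    assume "\<one> \<in> J"
    then have "shrinking \<subseteq> R" using S_carrier by (auto simp: J_iff subset_iff)
    then have "valuation_subring R K"
      unfolding valuation_subring_def using R S_total by blast
    with not_valuation show False by simp
  qed
  then show thesis
    using that[of F J] F J R_mult val S_carrier unfolding J_def by auto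
qed

end

section \<open>Dp-minimal domains\<close>

text \<open>Failure of the bound leaves infinitely many or more than \<open>n\<close> cosets. The
  representatives serve as the entries of a pattern row.\<close>

lemma index_large:
  assumes "A \<noteq> {}" "\<not> (index G A L \<noteq> 0 \<and> index G A L \<le> n)"
  obtains f where "\<And>i. i < n \<Longrightarrow> f i \<in> A"
    "\<And>i j. i < n \<Longrightarrow> j < n \<Longrightarrow> L +>\<^bsub>G\<^esub> f i = L +>\<^bsub>G\<^esub> f j \<Longrightarrow> i = j"
proof -
  let ?I = "(\<lambda>x. L +>\<^bsub>G\<^esub> x) ` A"
  have "infinite ?I \<or> n \<le> card ?I"
    using assms by (auto simp: index_def card_eq_0_iff)
  then obtain T where T: "T \<subseteq> ?I" "card T = n" "finite T"
    by (metis infinite_arbitrarily_large obtain_subset_with_card_n)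
  obtain h where h: "bij_betw h {..<n} T"
    using ex_bij_betw_nat_finite[OF T(3)] T(2) by (auto simp: atLeast0LessThan)
  have "\<exists>x \<in> A. L +>\<^bsub>G\<^esub> x = h i" if "i < n" for i
    using bij_betwE[OF h] T(1) that by fastforce
  then obtain f where "\<And>i. i < n \<Longrightarrow> f i \<in> A \<and> L +>\<^bsub>G\<^esub> f i = h i" by metis
  then show thesis
    using that[of f] bij_betw_imp_inj_on[OF h] by (auto dest: inj_onD)
qed

section \<open>Expressing fractions inside the structure\<close>

locale fraction_structure = field_subring K R
  for K :: "('a, 'm) ring_scheme" (structure) and R :: "'a set" +
  fixes M :: "('f, 'r, 'a) fo_struct" and addsym mulsym :: 'f
  assumes frac: "is_fraction_field K R"
    and M: "expands_ring M addsym mulsym (K\<lparr>carrier := R\<rparr>)"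
begin

abbreviation add_tm :: "'f tm \<Rightarrow> 'f tm \<Rightarrow> 'f tm" where
  "add_tm s t \<equiv> App addsym [s, t]"

abbreviation mul_tm :: "'f tm \<Rightarrow> 'f tm \<Rightarrow> 'f tm" where
  "mul_tm s t \<equiv> App mulsym [s, t]"

lemma dom_M [simp]: "dom M = R"
  using M by (simp add: expands_ring_def)

lemma is_fo_struct_M: "is_fo_struct M"
  using M by (simp add: expands_ring_def)

lemma funs_M [simp]:
  "x \<in> R \<Longrightarrow> y \<in> R \<Longrightarrow> funs M addsym [x, y] = x \<oplus> y"
  "x \<in> R \<Longrightarrow> y \<in> R \<Longrightarrow> funs M mulsym [x, y] = x \<otimes> y"
  using M by (auto simp: expands_ring_def)

lemma fractionE:
  assumes "c \<in> carrier K"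
  obtains a b where "a \<in> R" "b \<in> R" "b \<noteq> \<zero>" "c = a \<otimes> inv b"
  using frac assms unfolding is_fraction_field_def by blast

text \<open>Clearing denominators: for \<open>x\<close> and \<open>y\<close> in \<open>R\<close>, an
  equation in \<open>K\<close> becomes one between products in \<open>R\<close>, which a formula can
  state.\<close>

lemma fraction_mult_eq_iff:
  assumes "a \<in> R" "b \<in> R" "b \<noteq> \<zero>" "x \<in> carrier K" "y \<in> carrier K"
  shows "(a \<otimes> inv b) \<otimes> x = y \<longleftrightarrow> a \<otimes> x = b \<otimes> y"
proof -
  have b: "b \<in> carrier K - {\<zero>}" and a: "a \<in> carrier K" using assms R_closed(1) by auto
  have "b \<otimes> ((a \<otimes> inv b) \<otimes> x) = (b \<otimes> inv b) \<otimes> (a \<otimes> x)"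
    using a b nonzero_inv(1)[OF b] assms(4) by (simp add: m_ac)
  also have "\<dots> = a \<otimes> x" using a assms(4) nonzero_inv(2)[OF b] by simp
  finally have eq: "b \<otimes> ((a \<otimes> inv b) \<otimes> x) = a \<otimes> x" .
  have "(a \<otimes> inv b) \<otimes> x = y \<longleftrightarrow> b \<otimes> ((a \<otimes> inv b) \<otimes> x) = b \<otimes> y"
    using m_lcancel[of b] a b nonzero_inv(1)[OF b] assms(4,5) by simp
  then show ?thesis unfolding eq .
qed

lemma conductor_fraction_iff:
  assumes "a \<in> R" "b \<in> R" "b \<noteq> \<zero>" "x \<in> R"
  shows "x \<in> conductor (a \<otimes> inv b) \<longleftrightarrow> (\<exists>z \<in> R. x \<otimes> a = z \<otimes> b)"
proof -
  have c: "a \<otimes> inv b \<in> carrier K" using assms R_closed(1) nonzero_inv(1)[of b] by auto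
  have "x \<otimes> (a \<otimes> inv b) = z \<longleftrightarrow> x \<otimes> a = z \<otimes> b" if "z \<in> R" for z
    using fraction_mult_eq_iff[OF assms(1-3), of x z] assms that R_closed(1) c
    by (simp add: m_comm)
  then show ?thesis using assms(4) by (auto simp: conductor_def)
qed

section \<open>Patterns from independent conductors\<close>

text \<open>An independent family of \<open>2 * m\<close> conductors is arranged in two rows of
  length \<open>m\<close>. Adding the independence witnesses of one member from each row gives an
  element outside exactly these two members, so the complements form a pattern of depth 2.\<close>

lemma no_independent_conductors:
  assumes "dp_minimal M"
  shows "\<exists>n. \<forall>F. F \<subseteq> carrier K - {\<zero>} \<and> finite F \<and> card F = n \<longrightarrow>
           \<not> subgroup_independent R conductor F"
proof -
  \<comment> \<open>The formula says that variable 0 lies outside the conductor of the fraction with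
    numerator at 1 and denominator at 2.\<close>
  define \<psi> :: "('f, 'r) fm" where
    "\<psi> = Neg (Ex 3 (Eq (mul_tm (Var 0) (Var 1)) (mul_tm (Var 3) (Var 2))))"
  obtain m where m: "\<And>b. \<not> finite_ict_pattern M 2 (\<lambda>_. \<psi>) m b"
    using dp_minimal_pattern_bound[OF is_fo_struct_M assms, of 2 "\<lambda>_. \<psi>"] by auto
  have "\<not> subgroup_independent R conductor F"
    if F: "F \<subseteq> carrier K - {\<zero>}" "finite F" "card F = 2 * m" for F
  proof
    assume "subgroup_independent R conductor F"
    then obtain w where w: "\<And>c. c \<in> F \<Longrightarrow> w c \<in> R \<and> w c \<notin> conductor c"
        "\<And>c d. c \<in> F \<Longrightarrow> d \<in> F \<Longrightarrow> d \<noteq> c \<Longrightarrow> w c \<in> conductor d"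
      unfolding subgroup_independent_def by (metis DiffI singletonD)
    have "\<exists>a b. a \<in> R \<and> b \<in> R \<and> b \<noteq> \<zero> \<and> c = a \<otimes> inv b" if "c \<in> F" for c
      using that F(1) fractionE[of c] by (metis DiffD1 subsetD)
    then obtain num den where nd: "\<And>c. c \<in> F \<Longrightarrow>
        num c \<in> R \<and> den c \<in> R \<and> den c \<noteq> \<zero> \<and> c = num c \<otimes> inv (den c)"
      by metis
    obtain h where h: "bij_betw h {..<2 * m} F"
      using ex_bij_betw_nat_finite[OF F(2)] F(3) by (auto simp: atLeast0LessThan)
    \<comment> \<open>Row \<open>i\<close> consists of the \<open>m\<close> consecutive members
      starting at position \<open>i * m\<close>.\<close>
    define g where "g i j = h (i * m + j)" for i j
    have idx: "i * m + j < 2 * m" if "i < 2" "j < m" for i j :: nat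
      using that by (cases i) auto
    have gF: "g i j \<in> F" if "i < 2" "j < m" for i j
      using bij_betwE[OF h] idx[OF that] by (simp add: g_def)
    have g_inj: "i = i' \<and> j = j'" if "g i j = g i' j'" "i < 2" "j < m" "i' < 2" "j' < m" for i j i' j'
    proof -
      have "i * m + j = i' * m + j'"
        using that bij_betw_imp_inj_on[OF h] idx by (auto simp: g_def dest: inj_onD)
      then show ?thesis using that by (auto simp: less_2_cases_iff)
    qed
    define b where "b i j k = (if i < 2 \<and> j < m then
        if k = 0 then num (g i j) else den (g i j) else \<zero>)" for i j and k :: nat
    have sat: "sat M (case_nat x (b i j)) \<psi> \<longleftrightarrow> x \<notin> conductor (g i j)"
      if "i < 2" "j < m" "x \<in> R" for i j x
      using nd[OF gF[OF that(1,2)]] that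
        conductor_fraction_iff[of "num (g i j)" "den (g i j)" x]
      by (simp add: \<psi>_def b_def)
    have "finite_ict_pattern M 2 (\<lambda>_. \<psi>) m b"
      unfolding finite_ict_pattern_def
    proof (intro conjI allI impI)
      show "range (b i j) \<subseteq> dom M" if "i < 2" "j < m" for i j
        using nd[OF gF[OF that]] that by (auto simp: b_def)
      fix \<eta> :: "nat \<Rightarrow> nat" assume "\<forall>i<2. \<eta> i < m"
      then have \<eta>: "\<eta> 0 < m" "\<eta> 1 < m" by auto
      \<comment> \<open>\<open>u i\<close> avoids the conductor chosen in row \<open>i\<close> and
        lies in all others of both rows.\<close>
      define u where "u i = w (g i (\<eta> i))" for i
      have uR: "u 0 \<in> R" "u 1 \<in> R" using w(1) gF \<eta> by (auto simp: u_def)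
      have u: "u i \<in> conductor (g i' j) \<longleftrightarrow> \<not> (i = i' \<and> j = \<eta> i)"
        if "i < 2" "i' < 2" "j < m" for i i' j
      proof -
        have "\<eta> i < m" using \<eta> that(1) by (auto simp: less_2_cases_iff)
        then show ?thesis
          using w gF g_inj that unfolding u_def by metis
      qed
      show "\<exists>x\<in>dom M. \<forall>i<2. \<forall>j<m. sat M (case_nat x (b i j)) \<psi> \<longleftrightarrow> j = \<eta> i"
      proof (intro bexI allI impI)
        show "u 0 \<oplus> u 1 \<in> dom M" using uR R_closed by simp
        fix i j :: nat assume ij: "i < 2" "j < m"
        have "g i j \<in> carrier K" using gF[OF ij] F(1) by blast
        then have C: "additive_subgroup (conductor (g i j)) K" by (rule additive_subgroup_conductor)
        have "u 0 \<oplus> u 1 \<in> conductor (g i j) \<longleftrightarrow> j \<noteq> \<eta> i"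
        \<comment> \<open>The summand from the other row lies in \<open>conductor (g i j)\<close>,
          so it does not affect membership of the sum.\<close>
        proof (cases "i = 0")
          case True
          then have "u 1 \<in> conductor (g i j)" using u[of 1 i j] ij by simp
          then have "u 0 \<oplus> u 1 \<in> conductor (g i j) \<longleftrightarrow> u 0 \<in> conductor (g i j)"
            using add_mem_iff[OF C] uR R_closed(1) by simp
          then show ?thesis using u[of 0 i j] ij True by simp
        next
          case False
          then have "u 0 \<in> conductor (g i j)" "i = 1" using u[of 0 i j] ij by auto
          then have "u 0 \<oplus> u 1 \<in> conductor (g i j) \<longleftrightarrow> u 1 \<in> conductor (g i j)"
            using add_mem_iff[OF C, of "u 0" "u 1"] uR R_closed(1) by (simp add: a_comm)
          then show ?thesis using u[of 1 i j] ij \<open>i = 1\<close> by simp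
        qed
        then show "sat M (case_nat (u 0 \<oplus> u 1) (b i j)) \<psi> \<longleftrightarrow> j = \<eta> i"
          using sat[OF ij] uR R_closed by simp
      qed
    qed
    with m show False by blast
  qed
  then show ?thesis by blast
qed

section \<open>Patterns from cosets of principal ideals\<close>

text \<open>Multiplying by \<open>b\<close> turns the pair \<open>(a/b)R\<close>, \<open>R\<close>
  into \<open>aR\<close>, \<open>bR\<close>, which lie inside \<open>R\<close> and are definable
  there.\<close>

lemma scale_fraction_index:
  assumes "a \<in> R" "b \<in> R" "b \<noteq> \<zero>" "a \<noteq> \<zero>"
  shows "index K (scale (a \<otimes> inv b) R) R = index K (scale a R) (scale b R)"
    "index K R (scale (a \<otimes> inv b) R) = index K (scale b R) (scale a R)"
proof -
  have b: "b \<in> carrier K - {\<zero>}" and a: "a \<in> carrier K" using assms R_closed(1) by auto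
  note cc = nonzero_inv[OF b]
  have RK: "R \<subseteq> carrier K" using R_closed(1) by blast
  have "b \<otimes> (a \<otimes> inv b) = a" using a b cc m_lcomm[of b a "inv b"] by simp
  then have eq: "scale b (scale (a \<otimes> inv b) R) = scale a R"
    using a b cc scale_scale[of b "a \<otimes> inv b" R] RK by simp
  have sub: "additive_subgroup (scale (a \<otimes> inv b) R) K"
    using a cc by (intro additive_subgroup_scale additive_subgroup_R) auto
  show "index K (scale (a \<otimes> inv b) R) R = index K (scale a R) (scale b R)"
    "index K R (scale (a \<otimes> inv b) R) = index K (scale b R) (scale a R)"
    using index_scale[OF b sub additive_subgroup_R] index_scale[OF b additive_subgroup_R sub] eq
    by simp_all
qed

text \<open>Otherwise \<open>n\<close> elements \<open>f j\<close> of \<open>aR\<close> are distinct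
  modulo \<open>bR\<close>, and \<open>n\<close> elements \<open>g j\<close> of \<open>bR\<close>
  are distinct modulo \<open>aR\<close>. The sum \<open>f j \<oplus> g l\<close> lies in
  \<open>f j + bR\<close> and \<open>g l + aR\<close> but in no other coset listed, so these cosets
  form a pattern of depth 2.\<close>

lemma scales_comparable:
  assumes "dp_minimal M"
  shows "\<exists>k. \<forall>c \<in> carrier K - {\<zero>}.
      index K (scale c R) R \<noteq> 0 \<and> index K (scale c R) R \<le> k \<or>
      index K R (scale c R) \<noteq> 0 \<and> index K R (scale c R) \<le> k"
proof -
  \<comment> \<open>Variable 0 lies in the coset of variable 1 modulo the principal ideal of
    variable 2; with the modulus as a parameter, one formula serves both rows.\<close>
  define \<phi> :: "('f, 'r) fm" where
    "\<phi> = Ex 3 (Eq (Var 0) (add_tm (Var 1) (mul_tm (Var 2) (Var 3))))"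
  obtain n where n: "\<And>b. \<not> finite_ict_pattern M 2 (\<lambda>_. \<phi>) n b"
    using dp_minimal_pattern_bound[OF is_fo_struct_M assms, of 2 "\<lambda>_. \<phi>"] by auto
  have "index K (scale c R) R \<noteq> 0 \<and> index K (scale c R) R \<le> n \<or>
        index K R (scale c R) \<noteq> 0 \<and> index K R (scale c R) \<le> n"
    if c: "c \<in> carrier K - {\<zero>}" for c
  proof (rule ccontr)
    assume neg: "\<not> ?thesis"
    obtain a b where ab: "a \<in> R" "b \<in> R" "b \<noteq> \<zero>" "c = a \<otimes> inv b"
      using c fractionE by blast
    then have "a \<noteq> \<zero>" using c nonzero_inv(1)[of b] R_closed(1) by auto
    note ind = scale_fraction_index[OF ab(1-3) this, folded ab(4)]
    have A: "additive_subgroup (scale a R) K" and B: "additive_subgroup (scale b R) K"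
      using ab R_closed(1) by (auto intro: additive_subgroup_scale additive_subgroup_R)
    have sub: "scale a R \<subseteq> R" "scale b R \<subseteq> R"
      using ab R_closed(5) by (auto simp: scale_def)
    obtain f where f: "\<And>i. i < n \<Longrightarrow> f i \<in> scale a R"
        "\<And>i j. i < n \<Longrightarrow> j < n \<Longrightarrow> scale b R +> f i = scale b R +> f j \<Longrightarrow> i = j"
      using neg ind index_large[of "scale a R" K "scale b R" n] additive_subgroup_nonempty[OF A] by metis
    obtain g where g: "\<And>i. i < n \<Longrightarrow> g i \<in> scale b R"
        "\<And>i j. i < n \<Longrightarrow> j < n \<Longrightarrow> scale a R +> g i = scale a R +> g j \<Longrightarrow> i = j"
      using neg ind index_large[of "scale b R" K "scale a R" n] additive_subgroup_nonempty[OF B] by metis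
    define p where "p i j k = (if j < n then
        if i = 0 then (if k = 0 then f j else b) else (if k = 0 then g j else a) else \<zero>)"
      for i j k :: nat
    have sat: "sat M (case_nat x q) \<phi> \<longleftrightarrow> x \<ominus> q 0 \<in> scale (q 1) R"
      if "x \<in> R" "q 0 \<in> R" "q 1 \<in> R" for x q
    proof -
      have "x = q 0 \<oplus> q 1 \<otimes> z \<longleftrightarrow> x \<ominus> q 0 = q 1 \<otimes> z" if z: "z \<in> R" for z
      proof -
        have cl: "x \<in> carrier K" "q 0 \<in> carrier K" "q 1 \<otimes> z \<in> carrier K"
          using \<open>x \<in> R\<close> \<open>q 0 \<in> R\<close> \<open>q 1 \<in> R\<close> z R_closed(1) by auto
        have "q 0 \<oplus> (x \<ominus> q 0) = x" using cl by (simp add: minus_eq a_lcomm r_neg)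
        moreover have "q 0 \<oplus> q 1 \<otimes> z \<ominus> q 0 = q 1 \<otimes> z"
          using cl by (simp add: minus_eq a_ac r_neg1 r_neg2 r_neg)
        ultimately show ?thesis by metis
      qed
      then show ?thesis using that R_closed by (auto simp: \<phi>_def scale_def)
    qed
    have "finite_ict_pattern M 2 (\<lambda>_. \<phi>) n p"
      unfolding finite_ict_pattern_def
    proof (intro conjI allI impI)
      show "range (p i j) \<subseteq> dom M" if "i < 2" "j < n" for i j
        using f(1)[of j] g(1)[of j] sub ab that by (auto simp: p_def)
      fix \<eta> :: "nat \<Rightarrow> nat" assume "\<forall>i<2. \<eta> i < n"
      then have \<eta>: "\<eta> 0 < n" "\<eta> 1 < n" by auto
      let ?x = "f (\<eta> 0) \<oplus> g (\<eta> 1)"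
      have fgR: "f j \<in> R" "g j \<in> R" "f j \<in> carrier K" "g j \<in> carrier K" if "j < n" for j
        using f(1)[OF that] g(1)[OF that] sub R_closed(1) by auto
      show "\<exists>x\<in>dom M. \<forall>i<2. \<forall>j<n. sat M (case_nat x (p i j)) \<phi> \<longleftrightarrow> j = \<eta> i"
      proof (intro bexI allI impI)
        show "?x \<in> dom M" using fgR \<eta> R_closed by simp
        fix i j :: nat assume ij: "i < 2" "j < n"
        show "sat M (case_nat ?x (p i j)) \<phi> \<longleftrightarrow> j = \<eta> i"
        proof (cases "i = 0")
          case True
          \<comment> \<open>The summand from \<open>g\<close> lies in \<open>bR\<close> and vanishes
            modulo it, leaving a comparison within the first row.\<close>
          have "?x \<ominus> f j = (f (\<eta> 0) \<ominus> f j) \<oplus> g (\<eta> 1)"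
            using fgR \<eta> ij by (simp add: minus_eq a_ac)
          then have "?x \<ominus> f j \<in> scale b R \<longleftrightarrow> f (\<eta> 0) \<ominus> f j \<in> scale b R"
            using add_mem_iff[OF B] g(1) \<eta> fgR ij by simp
          also have "\<dots> \<longleftrightarrow> \<eta> 0 = j"
            using coset_eq_iff[OF B, of "f (\<eta> 0)" "f j"] f(2) \<eta> fgR ij by auto
          finally show ?thesis
            using sat[of ?x "p i j"] True ij fgR \<eta> ab R_closed by (auto simp: p_def)
        next
          case False
          then have "i = 1" using ij by simp
          have "?x \<ominus> g j = (g (\<eta> 1) \<ominus> g j) \<oplus> f (\<eta> 0)"
            using fgR \<eta> ij by (simp add: minus_eq a_ac)
          then have "?x \<ominus> g j \<in> scale a R \<longleftrightarrow> g (\<eta> 1) \<ominus> g j \<in> scale a R"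
            using add_mem_iff[OF A] f(1) \<eta> fgR ij by simp
          also have "\<dots> \<longleftrightarrow> \<eta> 1 = j"
            using coset_eq_iff[OF A, of "g (\<eta> 1)" "g j"] g(2) \<eta> fgR ij by auto
          finally show ?thesis
            using sat[of ?x "p i j"] \<open>i = 1\<close> ij fgR \<eta> ab R_closed by (auto simp: p_def)
        qed
      qed
    qed
    with n show False by blast
  qed
  then show ?thesis by blast
qed

section \<open>Definability in the fraction field\<close>

text \<open>In the defining formulas below, variables \<open>0\<close> and \<open>1\<close> are the numerator and the denominator of
  the element of \<open>K\<close>, \<open>2\<close> to \<open>4\<close> are bound, \<open>5\<close> is the parameter \<open>0\<close>, and \<open>2i + 6\<close>, \<open>2i + 7\<close> are the
  numerator and the denominator of the \<open>i\<close>-th parameter from \<open>K\<close>.\<close>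

definition point :: "'a \<Rightarrow> 'a \<Rightarrow> (nat \<Rightarrow> 'a) \<Rightarrow> nat \<Rightarrow> 'a" where
  "point a b p k = (if k < 2 then [a, b] ! k else p k)"

lemma point_simps [simp]:
  "point a b p 0 = a" "point a b p (Suc 0) = b" "2 \<le> k \<Longrightarrow> point a b p k = p k"
  by (simp_all add: point_def)

lemma frac_definableI:
  assumes p: "range p \<subseteq> R" "p 5 = \<zero>"
    and \<phi>: "\<And>a b. a \<in> R \<Longrightarrow> b \<in> R \<Longrightarrow> b \<noteq> \<zero> \<Longrightarrow> a \<otimes> inv b \<in> X \<longleftrightarrow> sat M (point a b p) \<phi>"
  shows "frac_definable M K R X"
proof -
  \<comment> \<open>Only addition and multiplication are guaranteed symbols, so zero is supplied as
    the parameter at 5.\<close>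
  let ?\<phi> = "Conj (Neg (Eq (Var 1) (Var 5))) \<phi>"
  have env: "(\<lambda>k. if k < 2 then [a, b] ! k else p k) = point a b p" for a b
    by (simp add: point_def fun_eq_iff)
  have "{[a, b] |a b. a \<in> R \<and> b \<in> R - {\<zero>} \<and> a \<otimes> inv b \<in> X} =
        {xs. length xs = 2 \<and> set xs \<subseteq> dom M \<and> sat M (\<lambda>k. if k < 2 then xs ! k else p k) ?\<phi>}"
    (is "?L = ?R")
  proof (intro equalityI subsetI)
    fix xs assume "xs \<in> ?L"
    then obtain a b where xs: "xs = [a, b]" "a \<in> R" "b \<in> R" "b \<noteq> \<zero>" "a \<otimes> inv b \<in> X" by blast
    then show "xs \<in> ?R" using p(2) \<phi> by (simp add: env)
  next
    fix xs assume "xs \<in> ?R"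
    then have len: "length xs = 2" and sub: "set xs \<subseteq> R"
      and s: "sat M (\<lambda>k. if k < 2 then xs ! k else p k) ?\<phi>" by auto
    from len obtain a b where xs: "xs = [a, b]"
      by (auto simp: numeral_2_eq_2 length_Suc_conv)
    with s have "sat M (point a b p) ?\<phi>" by (simp only: env)
    with xs sub show "xs \<in> ?L" using p(2) \<phi> by auto
  qed
  with p(1) show ?thesis
    unfolding frac_definable_def definable_def by (metis dom_M)
qed

definition conductor_fm :: "nat \<Rightarrow> nat \<Rightarrow> ('f, 'r) fm" where
  "conductor_fm v i =
     Ex 4 (Eq (mul_tm (Var v) (Var (2 * i + 6))) (mul_tm (Var 4) (Var (2 * i + 7))))"

primrec conductors_fm :: "nat \<Rightarrow> nat \<Rightarrow> ('f, 'r) fm" where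
  "conductors_fm v 0 = Eq (Var v) (Var v)"
| "conductors_fm v (Suc i) = Conj (conductors_fm v i) (conductor_fm v i)"

definition fraction_params :: "('a \<times> 'a) list \<Rightarrow> nat \<Rightarrow> 'a" where
  "fraction_params cs k =
     (if k < 6 \<or> length cs \<le> (k - 6) div 2 then \<zero>
      else (if even k then fst else snd) (cs ! ((k - 6) div 2)))"

lemma fraction_params_simps:
  "k < 6 \<Longrightarrow> fraction_params cs k = \<zero>"
  "i < length cs \<Longrightarrow> fraction_params cs (2 * i + 6) = fst (cs ! i)"
  "i < length cs \<Longrightarrow> fraction_params cs (2 * i + 7) = snd (cs ! i)"
  by (auto simp: fraction_params_def)

lemma range_fraction_params:
  assumes "set cs \<subseteq> R \<times> (R - {\<zero>})"
  shows "range (fraction_params cs) \<subseteq> R"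
proof -
  have "fst (cs ! i) \<in> R \<and> snd (cs ! i) \<in> R" if "i < length cs" for i
    using subsetD[OF assms nth_mem[OF that]] by (auto simp: mem_Times_iff)
  then show ?thesis using R_closed by (auto simp: fraction_params_def)
qed

text \<open>Each conjunct is the divisibility condition of \<open>conductor_fraction_iff\<close>.
  The condition \<open>v \<noteq> 4\<close> prevents capture by the quantifier in
  \<open>conductor_fm\<close>.\<close>

lemma sat_conductors_fm:
  assumes cs: "set cs \<subseteq> R \<times> (R - {\<zero>})" and v: "v \<noteq> 4" "e v \<in> R"
    and e: "\<And>k. 5 \<le> k \<Longrightarrow> e k = fraction_params cs k"
  shows "sat M e (conductors_fm v (length cs)) \<longleftrightarrow>
         e v \<in> R \<inter> (\<Inter>c \<in> (\<lambda>(a, b). a \<otimes> inv b) ` set cs. conductor c)"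
proof -
  have "sat M e (conductor_fm v i) \<longleftrightarrow> e v \<in> conductor (fst (cs ! i) \<otimes> inv (snd (cs ! i)))"
    if i: "i < length cs" for i
  proof -
    have nd: "fst (cs ! i) \<in> R" "snd (cs ! i) \<in> R" "snd (cs ! i) \<noteq> \<zero>"
      using subsetD[OF cs nth_mem[OF i]] by (auto simp: mem_Times_iff)
    show ?thesis
      using v nd fraction_params_simps(2,3)[OF i] e[of "2 * i + 6"] e[of "2 * i + 7"]
        conductor_fraction_iff[OF nd v(2)]
      by (simp add: conductor_fm_def)
  qed
  then have "sat M e (conductors_fm v n) \<longleftrightarrow>
      (\<forall>i<n. e v \<in> conductor (fst (cs ! i) \<otimes> inv (snd (cs ! i))))" if "n \<le> length cs" for n
    using that by (induction n) (auto simp: less_Suc_eq)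
  then show ?thesis
    using v(2) by (auto simp: all_set_conv_all_nth split_beta)
qed

context
  fixes cs J p
  assumes cs: "set cs \<subseteq> R \<times> (R - {\<zero>})"
    and J: "J = R \<inter> (\<Inter>c \<in> (\<lambda>(a, b). a \<otimes> inv b) ` set cs. conductor c)"
  defines "p \<equiv> fraction_params cs"
begin

lemma p: "range p \<subseteq> R" "p 5 = \<zero>"
  using range_fraction_params[OF cs] by (auto simp: p_def fraction_params_simps)

lemma frac_definable_intersection: "frac_definable M K R J"
proof (rule frac_definableI[OF p])
  fix a b assume ab: "a \<in> R" "b \<in> R" "b \<noteq> \<zero>"
  let ?\<phi> = "Ex 2 (Conj (conductors_fm 2 (length cs)) (Eq (Var 0) (mul_tm (Var 1) (Var 2))))"
  have eq: "a \<otimes> inv b = x \<longleftrightarrow> a = b \<otimes> x" if "x \<in> R" for x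
    using fraction_mult_eq_iff[OF ab, of \<one> x] ab that R_closed(1) nonzero_inv(1)[of b] by simp
  have "sat M ((point a b p)(2 := x)) (conductors_fm 2 (length cs)) \<longleftrightarrow> x \<in> J" if "x \<in> R" for x
    using sat_conductors_fm[OF cs, of 2 "(point a b p)(2 := x)"] that J by (simp add: p_def)
  then have "sat M (point a b p) ?\<phi> \<longleftrightarrow> (\<exists>x \<in> R. x \<in> J \<and> a = b \<otimes> x)"
    using ab by auto
  also have "\<dots> \<longleftrightarrow> a \<otimes> inv b \<in> J"
  proof -
    have "x \<in> R" if "x \<in> J" for x using J that by blast
    then show ?thesis using eq by metis
  qed
  finally show "a \<otimes> inv b \<in> J \<longleftrightarrow> sat M (point a b p) ?\<phi>" by simp
qed

lemma frac_definable_multiplier: "frac_definable M K R (multiplier J)"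
proof (rule frac_definableI[OF p])
  fix a b assume ab: "a \<in> R" "b \<in> R" "b \<noteq> \<zero>"
  \<comment> \<open>For every \<open>x\<close> in \<open>J\<close> there is \<open>y\<close> in
    \<open>J\<close> with \<open>a x = b y\<close>. Both quantifiers may range over \<open>R\<close>
    because \<open>J\<close> is contained in it.\<close>
  let ?\<phi> = "Neg (Ex 2 (Conj (conductors_fm 2 (length cs))
      (Neg (Ex 3 (Conj (conductors_fm 3 (length cs))
        (Eq (mul_tm (Var 0) (Var 2)) (mul_tm (Var 1) (Var 3))))))))"
  have c: "a \<otimes> inv b \<in> carrier K" using ab R_closed(1) nonzero_inv(1)[of b] by auto
  have eq: "a \<otimes> inv b \<otimes> x = y \<longleftrightarrow> a \<otimes> x = b \<otimes> y" if "x \<in> R" "y \<in> R" for x y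
    using fraction_mult_eq_iff[OF ab, of x y] that R_closed(1) by simp
  have s2: "sat M ((point a b p)(2 := x)) (conductors_fm 2 (length cs)) \<longleftrightarrow> x \<in> J"
    if "x \<in> R" for x
    using sat_conductors_fm[OF cs, of 2 "(point a b p)(2 := x)"] that J by (simp add: p_def)
  have s3: "sat M ((point a b p)(2 := x, 3 := y)) (conductors_fm 3 (length cs)) \<longleftrightarrow> y \<in> J"
    if "y \<in> R" for x y
    using sat_conductors_fm[OF cs, of 3 "(point a b p)(2 := x, 3 := y)"] that J by (simp add: p_def)
  have "sat M (point a b p) ?\<phi> \<longleftrightarrow> (\<forall>x \<in> R. x \<in> J \<longrightarrow> (\<exists>y \<in> R. y \<in> J \<and> a \<otimes> x = b \<otimes> y))"
    using ab s2 s3 by simp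
  also have "\<dots> \<longleftrightarrow> a \<otimes> inv b \<in> multiplier J"
  proof -
    have JR: "x \<in> R" if "x \<in> J" for x using J that by blast
    have "(\<exists>y \<in> R. y \<in> J \<and> a \<otimes> x = b \<otimes> y) \<longleftrightarrow> a \<otimes> inv b \<otimes> x \<in> J" if "x \<in> R" for x
      using eq[OF that] JR by metis
    then show ?thesis using c JR unfolding multiplier_def by blast
  qed
  finally show "a \<otimes> inv b \<in> multiplier J \<longleftrightarrow> sat M (point a b p) ?\<phi>" by simp
qed

text \<open>A fraction lies in \<open>R\<close> exactly when its denominator divides its numerator.
  This yields definability of the finite subring, whose preimage is \<open>R\<close>.\<close>

lemma frac_definable_subring: "frac_definable M K R R"
proof (rule frac_definableI[OF p])
  fix a b assume ab: "a \<in> R" "b \<in> R" "b \<noteq> \<zero>"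
  let ?\<phi> = "Ex 2 (Eq (Var 0) (mul_tm (Var 1) (Var 2)))"
  have "a \<otimes> inv b = x \<longleftrightarrow> a = b \<otimes> x" if "x \<in> R" for x
    using fraction_mult_eq_iff[OF ab, of \<one> x] ab that R_closed(1) nonzero_inv(1)[of b] by simp
  moreover have "sat M (point a b p) ?\<phi> \<longleftrightarrow> (\<exists>x \<in> R. a = b \<otimes> x)"
    using ab by simp
  ultimately show "a \<otimes> inv b \<in> R \<longleftrightarrow> sat M (point a b p) ?\<phi>"
    by metis
qed

end

end

section \<open>Assembling the valuation ring, the ideal and the finite subring\<close>

theorem theorem6p18:
  fixes K :: "('a, 'm) ring_scheme" and R :: "'a set"
    and M :: "('f, 'r, 'a) fo_struct" and addsym mulsym :: 'f
  assumes "is_fraction_field K R"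
    and "expands_ring M addsym mulsym (K\<lparr>carrier := R\<rparr>)"
    and "dp_minimal M"
    and "\<not> valuation_subring R K"
  shows "\<exists>A I R0.
           valuation_subring A K \<and>
           ideal I (K\<lparr>carrier := A\<rparr>) \<and> I \<noteq> A \<and>
           subring R0 (K\<lparr>carrier := A\<rparr> Quot I) \<and> finite R0 \<and>
           R = {x \<in> A. I +>\<^bsub>K\<lparr>carrier := A\<rparr>\<^esub> x \<in> R0} \<and>
           frac_definable M K R A \<and> frac_definable M K R I \<and> quot_definable M K R A I R0"
proof -
  have "subring R K" "field K"
    using assms(1) by (auto simp: is_fraction_field_def subdomain_def subcring_def)
  then interpret fraction_structure K R M addsym mulsym
    using assms by (intro fraction_structure.intro field_subring.intro
        field_subring_axioms.intro fraction_structure_axioms.intro)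
  obtain k where k: "\<And>c. c \<in> carrier K - {\<zero>\<^bsub>K\<^esub>} \<Longrightarrow>
      index K (scale c R) R \<noteq> 0 \<and> index K (scale c R) R \<le> k \<or>
      index K R (scale c R) \<noteq> 0 \<and> index K R (scale c R) \<le> k"
    using scales_comparable[OF assms(3)] by blast
  obtain n where n: "\<And>F. F \<subseteq> carrier K - {\<zero>\<^bsub>K\<^esub>} \<Longrightarrow> finite F \<Longrightarrow> card F = n \<Longrightarrow>
      \<not> subgroup_independent R conductor F"
    using no_independent_conductors[OF assms(3)] by blast
  obtain F J where F: "finite F" "F \<subseteq> carrier K - {\<zero>\<^bsub>K\<^esub>}"
    and J: "J = R \<inter> (\<Inter>c\<in>F. conductor c)" "index K R J \<noteq> 0" "additive_subgroup J K"
      "R \<subseteq> multiplier J"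
    and val: "valuation_subring (multiplier J) K" and one: "\<one>\<^bsub>K\<^esub> \<notin> J"
    by (rule exists_valuation_multiplier[OF k n assms(4)])
  let ?A = "multiplier J"
  let ?KA = "K\<lparr>carrier := multiplier J\<rparr>"
  let ?R0 = "(\<lambda>x. J +>\<^bsub>?KA\<^esub> x) ` R"
  have JR: "J \<subseteq> R" using J(1) by blast
  have sub: "subring ?A K" by (rule subring_multiplier[OF J(3)])
  have ideal: "ideal J ?KA" using ideal_multiplier[OF J(3)] JR J(4) by blast
  \<comment> \<open>Cosets depend only on the addition, which restricting the carrier leaves
    unchanged; hence indices computed in \<open>K\<close> apply to the quotient ring.\<close>
  have coset: "J +>\<^bsub>?KA\<^esub> x = J +>\<^bsub>K\<^esub> x" for x
    by (simp add: a_r_coset_def r_coset_def)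
  have "finite ?R0" using J(2) unfolding coset index_def by (simp add: card_eq_0_iff)
  have "subring ?R0 (?KA Quot J)"
  proof (rule ring_hom_ring.img_is_subring[OF ideal.rcos_ring_hom_ring[OF ideal]])
    interpret A: ring ?KA by (rule subring_is_ring[OF sub])
    show "subring R ?KA"
    proof (rule A.subringI)
      show "R \<subseteq> carrier ?KA" "\<one>\<^bsub>?KA\<^esub> \<in> R" using J(4) R_closed by auto
      fix x assume x: "x \<in> R"
      have "\<ominus>\<^bsub>?KA\<^esub> x = \<ominus>\<^bsub>K\<^esub> x" using x J(4) by (intro a_inv_subring[OF sub]) auto
      then show "\<ominus>\<^bsub>?KA\<^esub> x \<in> R" using x R_closed by simp
      fix y assume "y \<in> R"
      with x show "x \<otimes>\<^bsub>?KA\<^esub> y \<in> R" "x \<oplus>\<^bsub>?KA\<^esub> y \<in> R" using R_closed by auto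
    qed
  qed
  \<comment> \<open>Since \<open>R\<close> contains \<open>J\<close>, it is a union of cosets of
    \<open>J\<close> and thus equals the preimage of its image.\<close>
  have pre: "{x \<in> ?A. J +>\<^bsub>?KA\<^esub> x \<in> ?R0} = R"
  proof (intro equalityI subsetI)
    fix x assume "x \<in> {x \<in> ?A. J +>\<^bsub>?KA\<^esub> x \<in> ?R0}"
    then obtain y where xy: "x \<in> carrier K" "y \<in> R" "J +>\<^bsub>K\<^esub> x = J +>\<^bsub>K\<^esub> y"
      unfolding coset by (auto simp: multiplier_def)
    then have "x \<ominus>\<^bsub>K\<^esub> y \<in> R" using coset_eq_iff[OF J(3)] R_closed(1) JR by blast
    then have "x \<ominus>\<^bsub>K\<^esub> y \<oplus>\<^bsub>K\<^esub> y \<in> R" using xy R_closed by blast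
    then show "x \<in> R" using xy R_closed(1) by (simp add: minus_eq a_assoc l_neg)
  qed (use J(4) in auto)
  \<comment> \<open>The finite set \<open>F\<close> is turned into a list of numerators and
    denominators, to serve as parameters in \<open>R\<close>.\<close>
  have "\<exists>a b. a \<in> R \<and> b \<in> R \<and> b \<noteq> \<zero>\<^bsub>K\<^esub> \<and> c = a \<otimes>\<^bsub>K\<^esub> inv\<^bsub>K\<^esub> b" if "c \<in> F" for c
    using that F(2) fractionE[of c] by (metis DiffD1 subsetD)
  then obtain num den where nd: "\<And>c. c \<in> F \<Longrightarrow>
      num c \<in> R \<and> den c \<in> R \<and> den c \<noteq> \<zero>\<^bsub>K\<^esub> \<and> c = num c \<otimes>\<^bsub>K\<^esub> inv\<^bsub>K\<^esub> (den c)"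
    by metis
  obtain l where l: "set l = F" using finite_list[OF F(1)] by blast
  define cs where "cs = map (\<lambda>c. (num c, den c)) l"
  have cs: "set cs \<subseteq> R \<times> (R - {\<zero>\<^bsub>K\<^esub>})" using nd l by (auto simp: cs_def)
  have "(\<lambda>(a, b). a \<otimes>\<^bsub>K\<^esub> inv\<^bsub>K\<^esub> b) ` set cs = F"
    using nd l by (force simp: cs_def image_image)
  then have Jcs: "J = R \<inter> (\<Inter>c \<in> (\<lambda>(a, b). a \<otimes>\<^bsub>K\<^esub> inv\<^bsub>K\<^esub> b) ` set cs. conductor c)"
    using J(1) by simp
  have "J \<noteq> ?A" using one subringE(3)[OF sub] by auto
  moreover have "quot_definable M K R ?A J ?R0"
    unfolding quot_definable_def pre by (rule frac_definable_subring[OF cs Jcs])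
  ultimately show ?thesis
    using val ideal \<open>subring ?R0 (?KA Quot J)\<close> \<open>finite ?R0\<close> pre[symmetric]
      frac_definable_multiplier[OF cs Jcs] frac_definable_intersection[OF cs Jcs]
    by blast
qed

end
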